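(* Let $(M^{2n+1},\theta,\xi,\eta,g)$ be a nearly cosymplectic manifold. Then for any $X$ and $Y$ in $TM$ (tangent at the same point) $$|(\nabla_X\theta)(Y)|^2+g(Y,\nabla_X\xi)^2=-R(X,Y,X,Y)+R(X,Y,\theta X,\theta Y).$$
   Context: An almost contact (metric) structure on a Riemannian manifold $(M^{2n+1},g)$ consists of a $(1,1)$-tensor $\theta$, a 1-form $\eta$ and a unit vector field $\xi$ with $\theta^2=-\mathrm{Id}+\eta\otimes\xi$, $\eta(\xi)=1$, compatible with the metric: $g(\theta X,\theta Y)=g(X,Y)-\eta(X)\eta(Y)$ (so $\eta=g(\xi,\cdot)$, $\theta\xi=0$ and $\theta$ is skew-symmetric). It is nearly cosymplectic, and $(M,\theta,\xi,\eta,g)$ is a nearly cosymplectic manifold, if $(\nabla_X\theta)(Y)+(\nabla_Y\theta)(X)=0$ for all $X,Y$, where $\nabla$ is the Levi-Civita connection of $g$. The curvature conventions are $R(X,Y)=[\nabla_X,\nabla_Y]-\nabla_{[X,Y]}$ and $R(X,Y,Z,W)=g(R(X,Y)Z,W)$. *)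

theory Defs
  imports "HOL-Analysis.Analysis" "HOL-Library.Function_Algebras"
begin

subsection \<open>Smooth maps between open subsets of normed spaces\<close>

text \<open>The case \<open>k = Suc j\<close> asks that \<open>f\<close> be differentiable and that every directional derivative be
  of class \<open>C^j\<close>. This is the usual notion when the domain is an open subset of a
  finite-dimensional space, the only case in which it is used.\<close>

fun Ck_on :: "nat \<Rightarrow> ('a::euclidean_space \<Rightarrow> 'b::real_normed_vector) \<Rightarrow> 'a set \<Rightarrow> bool" where
  "Ck_on 0 f S \<longleftrightarrow> continuous_on S f"
| "Ck_on (Suc k) f S \<longleftrightarrow> (\<forall>x\<in>S. f differentiable (at x)) \<and>
     (\<forall>v. Ck_on k (\<lambda>x. frechet_derivative f (at x) v) S)"

definition smooth_on :: "('a::euclidean_space \<Rightarrow> 'b::real_normed_vector) \<Rightarrow> 'a set \<Rightarrow> bool" where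
  "smooth_on f S \<longleftrightarrow> (\<forall>k. Ck_on k f S)"


subsection \<open>Smooth manifolds\<close>

text \<open>The manifold is the whole type \<open>'m\<close>, with the topology given by its type class; the smooth
  structure is given by an atlas, not required to be maximal. A chart is a pair \<open>(U, \<phi>)\<close> of its
  domain and its coordinate map; values of \<open>\<phi>\<close> outside \<open>U\<close> are irrelevant.\<close>

type_synonym ('m, 'e) atlas = "('m set \<times> ('m \<Rightarrow> 'e)) set"

definition smooth_atlas ::
    "('m::{t2_space,second_countable_topology}, 'e::euclidean_space) atlas \<Rightarrow> bool" where
  "smooth_atlas A \<longleftrightarrow>
     (\<Union>(U, \<phi>)\<in>A. U) = UNIV \<and>
     (\<forall>(U, \<phi>)\<in>A. open U \<and> open (\<phi> ` U) \<and> homeomorphism U (\<phi> ` U) \<phi> (inv_into U \<phi>)) \<and>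
     (\<forall>(U, \<phi>)\<in>A. \<forall>(V, \<psi>)\<in>A. smooth_on (\<psi> \<circ> inv_into U \<phi>) (\<phi> ` (U \<inter> V)))"

definition smooth_fun :: "('m, 'e::euclidean_space) atlas \<Rightarrow> ('m \<Rightarrow> real) \<Rightarrow> bool" where
  "smooth_fun A f \<longleftrightarrow> (\<forall>(U, \<phi>)\<in>A. smooth_on (f \<circ> inv_into U \<phi>) (\<phi> ` U))"


subsection \<open>Tangent vectors and vector fields\<close>

text \<open>Tangent vectors at \<open>p\<close> are the derivations at \<open>p\<close> of the algebra of smooth functions. As HOL
  functions are total, a derivation is extended by \<open>0\<close> to the functions that are not smooth, so
  that tangent vectors are equal iff they agree on smooth functions. The additive structure on
  tangent vectors and on vector fields is the pointwise one.\<close>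

type_synonym 'm tvec = "('m \<Rightarrow> real) \<Rightarrow> real"
type_synonym 'm vfield = "'m \<Rightarrow> 'm tvec"

definition tscale :: "real \<Rightarrow> 'm tvec \<Rightarrow> 'm tvec" where
  "tscale c v = (\<lambda>f. c * v f)"

definition tangent_space :: "('m, 'e::euclidean_space) atlas \<Rightarrow> 'm \<Rightarrow> 'm tvec set" where
  "tangent_space A p = {v.
     (\<forall>f h. smooth_fun A f \<longrightarrow> smooth_fun A h \<longrightarrow>
        v (\<lambda>q. f q + h q) = v f + v h \<and>
        v (\<lambda>q. f q * h q) = f p * v h + h p * v f) \<and>
     (\<forall>c f. smooth_fun A f \<longrightarrow> v (\<lambda>q. c * f q) = c * v f) \<and>
     (\<forall>f. \<not> smooth_fun A f \<longrightarrow> v f = 0)}"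

definition vector_fields :: "('m, 'e::euclidean_space) atlas \<Rightarrow> 'm vfield set" where
  "vector_fields A = {X. (\<forall>p. X p \<in> tangent_space A p) \<and>
     (\<forall>f. smooth_fun A f \<longrightarrow> smooth_fun A (\<lambda>p. X p f))}"

definition fscale :: "('m \<Rightarrow> real) \<Rightarrow> 'm vfield \<Rightarrow> 'm vfield" where
  "fscale f X = (\<lambda>p. tscale (f p) (X p))"

definition lie_bracket :: "'m vfield \<Rightarrow> 'm vfield \<Rightarrow> 'm vfield" where
  "lie_bracket X Y = (\<lambda>p f. X p (\<lambda>q. Y q f) - Y p (\<lambda>q. X q f))"


subsection \<open>Tensor fields\<close>

definition one_form :: "('m, 'e::euclidean_space) atlas \<Rightarrow> ('m \<Rightarrow> 'm tvec \<Rightarrow> real) \<Rightarrow> bool" where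
  "one_form A \<eta> \<longleftrightarrow>
     (\<forall>p. \<forall>x\<in>tangent_space A p. \<forall>y\<in>tangent_space A p. \<forall>c.
        \<eta> p (x + y) = \<eta> p x + \<eta> p y \<and> \<eta> p (tscale c x) = c * \<eta> p x) \<and>
     (\<forall>X\<in>vector_fields A. smooth_fun A (\<lambda>p. \<eta> p (X p)))"

definition apply_tensor :: "('m \<Rightarrow> 'm tvec \<Rightarrow> 'm tvec) \<Rightarrow> 'm vfield \<Rightarrow> 'm vfield" where
  "apply_tensor \<theta> X = (\<lambda>p. \<theta> p (X p))"

definition tensor_11 :: "('m, 'e::euclidean_space) atlas \<Rightarrow> ('m \<Rightarrow> 'm tvec \<Rightarrow> 'm tvec) \<Rightarrow> bool" where
  "tensor_11 A \<theta> \<longleftrightarrow>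
     (\<forall>p. \<forall>x\<in>tangent_space A p. \<theta> p x \<in> tangent_space A p) \<and>
     (\<forall>p. \<forall>x\<in>tangent_space A p. \<forall>y\<in>tangent_space A p. \<forall>c.
        \<theta> p (x + y) = \<theta> p x + \<theta> p y \<and> \<theta> p (tscale c x) = tscale c (\<theta> p x)) \<and>
     (\<forall>X\<in>vector_fields A. apply_tensor \<theta> X \<in> vector_fields A)"

definition riemannian_metric ::
    "('m, 'e::euclidean_space) atlas \<Rightarrow> ('m \<Rightarrow> 'm tvec \<Rightarrow> 'm tvec \<Rightarrow> real) \<Rightarrow> bool" where
  "riemannian_metric A g \<longleftrightarrow>
     (\<forall>p. \<forall>x\<in>tangent_space A p. \<forall>y\<in>tangent_space A p. \<forall>z\<in>tangent_space A p. \<forall>c.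
        g p x y = g p y x \<and>
        g p (x + y) z = g p x z + g p y z \<and>
        g p (tscale c x) y = c * g p x y) \<and>
     (\<forall>p. \<forall>x\<in>tangent_space A p. x \<noteq> 0 \<longrightarrow> g p x x > 0) \<and>
     (\<forall>X\<in>vector_fields A. \<forall>Y\<in>vector_fields A. smooth_fun A (\<lambda>p. g p (X p) (Y p)))"

definition metric_norm :: "('m \<Rightarrow> 'm tvec \<Rightarrow> 'm tvec \<Rightarrow> real) \<Rightarrow> 'm \<Rightarrow> 'm tvec \<Rightarrow> real" where
  "metric_norm g p x = sqrt (g p x x)"


subsection \<open>The Levi-Civita connection\<close>

definition affine_connection ::
    "('m, 'e::euclidean_space) atlas \<Rightarrow> ('m vfield \<Rightarrow> 'm vfield \<Rightarrow> 'm vfield) \<Rightarrow> bool" where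
  "affine_connection A D \<longleftrightarrow>
     (\<forall>X\<in>vector_fields A. \<forall>Y\<in>vector_fields A. D X Y \<in> vector_fields A) \<and>
     (\<forall>X\<in>vector_fields A. \<forall>Y\<in>vector_fields A. \<forall>Z\<in>vector_fields A.
        D (X + Y) Z = D X Z + D Y Z \<and> D X (Y + Z) = D X Y + D X Z) \<and>
     (\<forall>X\<in>vector_fields A. \<forall>Y\<in>vector_fields A. \<forall>f. smooth_fun A f \<longrightarrow>
        D (fscale f X) Y = fscale f (D X Y) \<and>
        D X (fscale f Y) = fscale (\<lambda>p. X p f) Y + fscale f (D X Y))"

definition levi_civita ::
    "('m, 'e::euclidean_space) atlas \<Rightarrow> ('m \<Rightarrow> 'm tvec \<Rightarrow> 'm tvec \<Rightarrow> real) \<Rightarrow>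
     ('m vfield \<Rightarrow> 'm vfield \<Rightarrow> 'm vfield) \<Rightarrow> bool" where
  "levi_civita A g D \<longleftrightarrow> affine_connection A D \<and>
     (\<forall>X\<in>vector_fields A. \<forall>Y\<in>vector_fields A. D X Y - D Y X = lie_bracket X Y) \<and>
     (\<forall>X\<in>vector_fields A. \<forall>Y\<in>vector_fields A. \<forall>Z\<in>vector_fields A. \<forall>p.
        X p (\<lambda>q. g q (Y q) (Z q)) = g p (D X Y p) (Z p) + g p (Y p) (D X Z p))"

definition tensor_deriv ::
    "('m vfield \<Rightarrow> 'm vfield \<Rightarrow> 'm vfield) \<Rightarrow> ('m \<Rightarrow> 'm tvec \<Rightarrow> 'm tvec) \<Rightarrow>
     'm vfield \<Rightarrow> 'm vfield \<Rightarrow> 'm vfield" where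
  "tensor_deriv D \<theta> X Y = D X (apply_tensor \<theta> Y) - apply_tensor \<theta> (D X Y)"

definition curvature ::
    "('m vfield \<Rightarrow> 'm vfield \<Rightarrow> 'm vfield) \<Rightarrow> 'm vfield \<Rightarrow> 'm vfield \<Rightarrow> 'm vfield \<Rightarrow> 'm vfield" where
  "curvature D X Y Z = D X (D Y Z) - D Y (D X Z) - D (lie_bracket X Y) Z"


subsection \<open>Values at a point\<close>

text \<open>\<open>D\<close> acts on global vector fields. Its action on tangent vectors at \<open>p\<close>, wherever it is
  tensorial, is obtained by extending the vectors to global fields; every tangent vector has such
  an extension, and the values below do not depend on the extension chosen.\<close>

definition extension :: "('m, 'e::euclidean_space) atlas \<Rightarrow> 'm \<Rightarrow> 'm tvec \<Rightarrow> 'm vfield" where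
  "extension A p x = (SOME X. X \<in> vector_fields A \<and> X p = x)"

definition deriv_at ::
    "('m, 'e::euclidean_space) atlas \<Rightarrow> ('m vfield \<Rightarrow> 'm vfield \<Rightarrow> 'm vfield) \<Rightarrow>
     'm \<Rightarrow> 'm tvec \<Rightarrow> 'm vfield \<Rightarrow> 'm tvec" where
  "deriv_at A D p x Y = D (extension A p x) Y p"

definition tensor_deriv_at ::
    "('m, 'e::euclidean_space) atlas \<Rightarrow> ('m vfield \<Rightarrow> 'm vfield \<Rightarrow> 'm vfield) \<Rightarrow>
     ('m \<Rightarrow> 'm tvec \<Rightarrow> 'm tvec) \<Rightarrow> 'm \<Rightarrow> 'm tvec \<Rightarrow> 'm tvec \<Rightarrow> 'm tvec" where
  "tensor_deriv_at A D \<theta> p x y = tensor_deriv D \<theta> (extension A p x) (extension A p y) p"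

definition riemann_at ::
    "('m, 'e::euclidean_space) atlas \<Rightarrow> ('m \<Rightarrow> 'm tvec \<Rightarrow> 'm tvec \<Rightarrow> real) \<Rightarrow>
     ('m vfield \<Rightarrow> 'm vfield \<Rightarrow> 'm vfield) \<Rightarrow>
     'm \<Rightarrow> 'm tvec \<Rightarrow> 'm tvec \<Rightarrow> 'm tvec \<Rightarrow> 'm tvec \<Rightarrow> real" where
  "riemann_at A g D p x y z w =
     g p (curvature D (extension A p x) (extension A p y) (extension A p z) p) w"


subsection \<open>Nearly cosymplectic structures\<close>

definition almost_contact_metric ::
    "('m, 'e::euclidean_space) atlas \<Rightarrow> ('m \<Rightarrow> 'm tvec \<Rightarrow> 'm tvec) \<Rightarrow> 'm vfield \<Rightarrow>
     ('m \<Rightarrow> 'm tvec \<Rightarrow> real) \<Rightarrow> ('m \<Rightarrow> 'm tvec \<Rightarrow> 'm tvec \<Rightarrow> real) \<Rightarrow> bool" where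
  "almost_contact_metric A \<theta> \<xi> \<eta> g \<longleftrightarrow>
     riemannian_metric A g \<and> tensor_11 A \<theta> \<and> one_form A \<eta> \<and> \<xi> \<in> vector_fields A \<and>
     (\<forall>p. metric_norm g p (\<xi> p) = 1) \<and>
     (\<forall>p. \<forall>x\<in>tangent_space A p. \<theta> p (\<theta> p x) = - x + tscale (\<eta> p x) (\<xi> p)) \<and>
     (\<forall>p. \<eta> p (\<xi> p) = 1) \<and>
     (\<forall>p. \<forall>x\<in>tangent_space A p. \<forall>y\<in>tangent_space A p.
        g p (\<theta> p x) (\<theta> p y) = g p x y - \<eta> p x * \<eta> p y)"

text \<open>\<open>D\<close> is meant to be the Levi-Civita connection of \<open>g\<close>.\<close>

definition nearly_cosymplectic ::
    "('m, 'e::euclidean_space) atlas \<Rightarrow> ('m \<Rightarrow> 'm tvec \<Rightarrow> 'm tvec) \<Rightarrow> 'm vfield \<Rightarrow>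
     ('m \<Rightarrow> 'm tvec \<Rightarrow> real) \<Rightarrow> ('m \<Rightarrow> 'm tvec \<Rightarrow> 'm tvec \<Rightarrow> real) \<Rightarrow>
     ('m vfield \<Rightarrow> 'm vfield \<Rightarrow> 'm vfield) \<Rightarrow> bool" where
  "nearly_cosymplectic A \<theta> \<xi> \<eta> g D \<longleftrightarrow> almost_contact_metric A \<theta> \<xi> \<eta> g \<and>
     (\<forall>X\<in>vector_fields A. \<forall>Y\<in>vector_fields A.
        tensor_deriv D \<theta> X Y + tensor_deriv D \<theta> Y X = 0)"

end

theory Submission
  imports Defs
begin

text \<open>Write \<open>N\<^sub>X = \<nabla>\<^sub>X\<theta>\<close>, so that \<open>N\<^sub>X Y = - N\<^sub>Y X\<close>. Differentiating \<open>\<theta>\<^sup>2 = - Id + \<eta> \<otimes> \<xi>\<close> gives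
  \<open>g(N\<^sub>Z Y, \<theta>Y) = - \<eta>(Y) g(\<nabla>\<^sub>Z\<xi>, Y)\<close>; for \<open>Z = Y\<close> the left-hand side vanishes, so \<open>\<xi>\<close> is Killing. A
  further derivative in direction \<open>X\<close> expresses \<open>g((\<nabla>\<^sup>2\<^bsub>X,X\<^esub>\<theta>)Y, \<theta>Y)\<close> by \<open>|N\<^sub>X Y|\<^sup>2\<close>, \<open>g(\<nabla>\<^sub>X\<xi>, Y)\<^sup>2\<close>
  and \<open>\<eta>(Y) g(\<nabla>\<^sup>2\<^bsub>X,X\<^esub>\<xi>, Y)\<close>. On the other hand \<open>(\<nabla>\<^sup>2\<^bsub>X,X\<^esub>\<theta>)Y = - (\<nabla>\<^sup>2\<^bsub>X,Y\<^esub>\<theta>)X\<close> and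
  \<open>(\<nabla>\<^sup>2\<^bsub>Y,X\<^esub>\<theta>)X = 0\<close>, so the Ricci identity turns the same quantity into curvature; the terms with the
  factor \<open>\<eta>(Y)\<close> cancel by the second-order equation of the Killing field \<open>\<xi>\<close>.\<close>

subsection \<open>Calculus of smooth maps\<close>

text \<open>On an open set \<open>frechet_derivative\<close> depends only on the values in that set.
  The induction varies \<open>f\<close> and \<open>g\<close> because it is applied again to their
  directional derivatives, which agree only on \<open>S\<close>.\<close>

lemma Ck_on_cong:
  assumes "open S" "\<And>x. x \<in> S \<Longrightarrow> f x = g x" "Ck_on k f S"
  shows "Ck_on k g S"
  using assms(2,3)
proof (induction k arbitrary: f g)
  case 0
  then show ?case by (metis Ck_on.simps(1) continuous_on_cong)
next
  case (Suc k)
  have fr: "frechet_derivative f (at x) = frechet_derivative g (at x)" if "x \<in> S" for x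
    using that Suc.prems assms(1) by (intro frechet_derivative_transform_within_open[of _ _ S]) auto
  have "g differentiable (at x)" if x: "x \<in> S" for x
  proof -
    obtain f' where "(f has_derivative f') (at x)"
      using Suc.prems x by (auto simp: differentiable_def)
    then show ?thesis
      unfolding differentiable_def
      using has_derivative_transform_within_open[OF _ assms(1) x] Suc.prems(1) by blast
  qed
  moreover have "Ck_on k (\<lambda>x. frechet_derivative g (at x) v) S" for v
    using Suc.IH[of "\<lambda>x. frechet_derivative f (at x) v" "\<lambda>x. frechet_derivative g (at x) v"]
      Suc.prems(2) fr by simp
  ultimately show ?case by simp
qed

text \<open>Replaces the choice-defined \<open>frechet_derivative\<close> by any explicit formula
  for the derivative, so that the closure properties follow from the usual differentiation
  rules.\<close>

lemma Ck_on_SucI: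
  assumes "open S" "\<And>x. x \<in> S \<Longrightarrow> (f has_derivative f' x) (at x)"
    and "\<And>v. Ck_on k (\<lambda>x. f' x v) S"
  shows "Ck_on (Suc k) f S"
proof -
  have "Ck_on k (\<lambda>x. frechet_derivative f (at x) v) S" for v
    using assms(1) _ assms(3)[of v]
    by (rule Ck_on_cong) (metis assms(2) frechet_derivative_at)
  then show ?thesis
    using assms(2) by (auto simp: differentiable_def)
qed

lemma Ck_on_SucD:
  assumes "Ck_on (Suc k) f S"
  shows "\<And>x. x \<in> S \<Longrightarrow> (f has_derivative frechet_derivative f (at x)) (at x)"
    and "\<And>v. Ck_on k (\<lambda>x. frechet_derivative f (at x) v) S"
  using assms frechet_derivative_works by auto

lemma Ck_on_Suc_imp: "Ck_on (Suc k) f S \<Longrightarrow> Ck_on k f S"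
proof (induction k arbitrary: f)
  case 0
  then show ?case
    by (auto intro!: continuous_at_imp_continuous_on differentiable_imp_continuous_within)
next
  case (Suc k)
  then show ?case by (metis Ck_on.simps(2))
qed

lemma Ck_on_le: "Ck_on k f S \<Longrightarrow> j \<le> k \<Longrightarrow> Ck_on j f S"
  by (induction k) (auto simp: le_Suc_eq simp del: Ck_on.simps dest: Ck_on_Suc_imp)

lemma Ck_on_subset: "Ck_on k f S \<Longrightarrow> T \<subseteq> S \<Longrightarrow> Ck_on k f T"
  by (induction k arbitrary: f) (auto intro: continuous_on_subset)

lemma Ck_on_Un:
  assumes "open S" "open T" "Ck_on k f S" "Ck_on k f T"
  shows "Ck_on k f (S \<union> T)"
  using assms(3,4) by (induction k arbitrary: f) (auto intro: continuous_on_open_Un assms)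

lemma Ck_on_const: "open S \<Longrightarrow> Ck_on k (\<lambda>x. c) S"
proof (induction k arbitrary: c)
  case (Suc k)
  then show ?case by (intro Ck_on_SucI[where f'="\<lambda>_ _. 0"]) auto
qed simp

lemma Ck_on_bounded_linear:
  assumes "bounded_linear L" "open S" "Ck_on k f S"
  shows "Ck_on k (\<lambda>x. L (f x)) S"
  using assms(3)
proof (induction k arbitrary: f)
  case 0
  then show ?case
    using bounded_linear.continuous_on[OF assms(1)] by simp
next
  case (Suc k)
  show ?case
    using Suc.IH Ck_on_SucD[OF Suc.prems]
    by (intro Ck_on_SucI[where f'="\<lambda>x v. L (frechet_derivative f (at x) v)"]
        bounded_linear.has_derivative[OF assms(1)] assms(2)) auto
qed

lemma Ck_on_ident: "open S \<Longrightarrow> Ck_on k (\<lambda>x. x) S"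
  by (cases k) (auto intro!: Ck_on_SucI[where f'="\<lambda>_ v. v"] Ck_on_const simp del: Ck_on.simps(2))

lemma Ck_on_add:
  assumes "open S" "Ck_on k f S" "Ck_on k g S"
  shows "Ck_on k (\<lambda>x. f x + g x) S"
  using assms(2,3)
proof (induction k arbitrary: f g)
  case 0
  then show ?case by (auto intro: continuous_on_add)
next
  case (Suc k)
  show ?case
    using Suc.IH Ck_on_SucD[OF Suc.prems(1)] Ck_on_SucD[OF Suc.prems(2)]
    by (intro Ck_on_SucI[where f'="\<lambda>x v. frechet_derivative f (at x) v + frechet_derivative g (at x) v"]
        has_derivative_add assms(1)) auto
qed

lemma Ck_on_sum:
  assumes "open S" "\<And>i. i \<in> I \<Longrightarrow> Ck_on k (f i) S"
  shows "Ck_on k (\<lambda>x. \<Sum>i\<in>I. f i x) S"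
  using assms(2)
  by (induction I rule: infinite_finite_induct) (auto intro!: Ck_on_const Ck_on_add assms(1))

lemma Ck_on_scaleR:
  assumes "open S" "Ck_on k f S" "Ck_on k g S"
  shows "Ck_on k (\<lambda>x. f x *\<^sub>R g x) S"
  using assms(2,3)
proof (induction k arbitrary: f g)
  case 0
  then show ?case by (auto intro: continuous_on_scaleR)
next
  case (Suc k)
  show ?case
    using Suc.IH Ck_on_SucD[OF Suc.prems(1)] Ck_on_SucD[OF Suc.prems(2)]
      Suc.prems[THEN Ck_on_Suc_imp]
    by (intro Ck_on_SucI[where f'="\<lambda>x v. f x *\<^sub>R frechet_derivative g (at x) v
          + frechet_derivative f (at x) v *\<^sub>R g x"]
        has_derivative_scaleR Ck_on_add assms(1)) auto
qed

text \<open>The chain rule evaluates the derivative of \<open>g\<close> in a direction that moves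
  with \<open>x\<close>, whereas \<open>Ck_on\<close> speaks of fixed directions only. Expanding
  that direction in \<open>Basis\<close> leaves sums of products to which the induction hypothesis
  applies.\<close>

lemma Ck_on_compose:
  fixes f :: "'a::euclidean_space \<Rightarrow> 'b::euclidean_space"
  assumes "open S" "open T" "f ` S \<subseteq> T" "Ck_on k f S" "Ck_on k g T"
  shows "Ck_on k (\<lambda>x. g (f x)) S"
  using assms(4,5)
proof (induction k arbitrary: g)
  case 0
  then show ?case using assms(3) by (auto intro: continuous_on_compose2)
next
  case (Suc k)
  note f = Ck_on_SucD[OF Suc.prems(1)] and g = Ck_on_SucD[OF Suc.prems(2)]
  define g' where "g' y = frechet_derivative g (at y)" for y
  define f' where "f' x = frechet_derivative f (at x)" for x
  have d: "((\<lambda>x. g (f x)) has_derivative (\<lambda>v. \<Sum>i\<in>Basis. (f' x v \<bullet> i) *\<^sub>R g' (f x) i)) (at x)"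
    if "x \<in> S" for x
  proof -
    have fx: "f x \<in> T" using that assms(3) by auto
    have "linear (g' (f x))"
      using g(1)[OF fx] has_derivative_linear unfolding g'_def by blast
    then have "g' (f x) (f' x v) = (\<Sum>i\<in>Basis. (f' x v \<bullet> i) *\<^sub>R g' (f x) i)" for v
      by (subst (1) euclidean_representation[of "f' x v", symmetric])
        (simp add: linear_sum linear_cmul)
    then show ?thesis
      using has_derivative_compose[OF f(1)[OF that] g(1)[OF fx]] by (simp add: f'_def g'_def)
  qed
  have "Ck_on k (\<lambda>x. f' x v \<bullet> i) S" for v i
    using Ck_on_bounded_linear[OF bounded_linear_inner_left assms(1) f(2)[of v], of i]
    by (simp add: f'_def)
  moreover have "Ck_on k (\<lambda>x. g' (f x) i) S" for i
    using Suc.IH[OF Ck_on_Suc_imp[OF Suc.prems(1)] g(2)[of i]] by (simp add: g'_def)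
  ultimately show ?case
    by (intro Ck_on_SucI[OF assms(1) d] Ck_on_sum Ck_on_scaleR assms(1)) auto
qed

section \<open>Closure properties of smooth maps\<close>

lemma smooth_on_cong:
  "open S \<Longrightarrow> (\<And>x. x \<in> S \<Longrightarrow> f x = g x) \<Longrightarrow> smooth_on f S \<Longrightarrow> smooth_on g S"
  using Ck_on_cong unfolding smooth_on_def by blast

lemma smooth_on_subset: "smooth_on f S \<Longrightarrow> T \<subseteq> S \<Longrightarrow> smooth_on f T"
  using Ck_on_subset unfolding smooth_on_def by blast

lemma smooth_on_Un:
  "open S \<Longrightarrow> open T \<Longrightarrow> smooth_on f S \<Longrightarrow> smooth_on f T \<Longrightarrow> smooth_on f (S \<union> T)"
  using Ck_on_Un unfolding smooth_on_def by blast

lemma smooth_on_const: "open S \<Longrightarrow> smooth_on (\<lambda>x. c) S"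
  by (simp add: smooth_on_def Ck_on_const)

lemma smooth_on_ident: "open S \<Longrightarrow> smooth_on (\<lambda>x. x) S"
  by (simp add: smooth_on_def Ck_on_ident)

lemma smooth_on_bounded_linear:
  "bounded_linear L \<Longrightarrow> open S \<Longrightarrow> smooth_on f S \<Longrightarrow> smooth_on (\<lambda>x. L (f x)) S"
  by (simp add: smooth_on_def Ck_on_bounded_linear)

lemma smooth_on_add:
  "open S \<Longrightarrow> smooth_on f S \<Longrightarrow> smooth_on g S \<Longrightarrow> smooth_on (\<lambda>x. f x + g x) S"
  by (simp add: smooth_on_def Ck_on_add)

lemma smooth_on_sum:
  "open S \<Longrightarrow> (\<And>i. i \<in> I \<Longrightarrow> smooth_on (f i) S) \<Longrightarrow> smooth_on (\<lambda>x. \<Sum>i\<in>I. f i x) S"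
  by (simp add: smooth_on_def Ck_on_sum)

lemma smooth_on_mult:
  fixes f g :: "'a::euclidean_space \<Rightarrow> real"
  shows "open S \<Longrightarrow> smooth_on f S \<Longrightarrow> smooth_on g S \<Longrightarrow> smooth_on (\<lambda>x. f x * g x) S"
  using Ck_on_scaleR[of S _ f g] by (simp add: smooth_on_def)

lemma smooth_on_compose:
  fixes f :: "'a::euclidean_space \<Rightarrow> 'b::euclidean_space"
  assumes "open S" "open T" "f ` S \<subseteq> T" "smooth_on f S" "smooth_on g T"
  shows "smooth_on (\<lambda>x. g (f x)) S"
  using Ck_on_compose[OF assms(1-3)] assms(4,5) unfolding smooth_on_def by blast

lemma smooth_on_continuous_on: "smooth_on f S \<Longrightarrow> continuous_on S f"
  unfolding smooth_on_def using Ck_on.simps(1) by blast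

lemma smooth_on_differentiable:
  "smooth_on f S \<Longrightarrow> x \<in> S \<Longrightarrow> f differentiable (at x)"
  unfolding smooth_on_def using Ck_on.simps(2) by blast

lemma smooth_on_frechet_derivative:
  "smooth_on f S \<Longrightarrow> smooth_on (\<lambda>x. frechet_derivative f (at x) v) S"
  unfolding smooth_on_def using Ck_on.simps(2) by blast

text \<open>These functions are closed under differentiation up to linear combinations, so \<open>exp (-1/t)\<close>
  (the case \<open>m = 0\<close>) is smooth across \<open>0\<close>.\<close>

definition flat_exp :: "nat \<Rightarrow> real \<Rightarrow> real" where
  "flat_exp m t = (if t > 0 then (1/t) ^ m * exp (- (1/t)) else 0)"

text \<open>From the right, the substitution \<open>x = inverse t\<close> turns this into the decay
  of \<open>x ^ m / exp x\<close> at infinity; from the left the function is constantly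
  \<open>0\<close>.\<close>

lemma flat_exp_tendsto_0: "(flat_exp m \<longlongrightarrow> 0) (at 0)"
proof -
  have "((\<lambda>x::real. x ^ m / exp x) \<longlongrightarrow> 0) at_top"
    by (rule tendsto_power_div_exp_0)
  then have "((\<lambda>t::real. (inverse t) ^ m / exp (inverse t)) \<longlongrightarrow> 0) (at_right 0)"
    by (rule filterlim_compose[OF _ filterlim_inverse_at_top_right])
  then have r: "(flat_exp m \<longlongrightarrow> 0) (at_right 0)"
  proof (rule Lim_transform_eventually)
    show "\<forall>\<^sub>F t in at_right 0. (inverse t) ^ m / exp (inverse t) = flat_exp m t"
      using eventually_at_right_less[of "0::real"]
      by eventually_elim (simp add: flat_exp_def exp_minus field_simps)
  qed
  have l: "(flat_exp m \<longlongrightarrow> 0) (at_left 0)"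
  proof (rule Lim_transform_eventually[OF tendsto_const])
    show "\<forall>\<^sub>F t in at_left (0::real). 0 = flat_exp m t"
      by (auto simp: flat_exp_def eventually_at_filter)
  qed
  show ?thesis using filterlim_split_at[OF l r] by simp
qed

lemma flat_exp_has_derivative:
  "(flat_exp m has_real_derivative flat_exp (m + 2) t - m * flat_exp (m + 1) t) (at t)"
proof -
  consider "t > 0" | "t < 0" | "t = 0" by linarith
  then show ?thesis
  proof cases
    case 1
    have "((\<lambda>t. (1/t) ^ m * exp (- (1/t))) has_real_derivative
        flat_exp (m + 2) t - m * flat_exp (m + 1) t) (at t)"
    \<comment> \<open>The split removes the truncated exponent \<open>m - 1\<close> from the
      derivative of the power.\<close>
    proof (cases m)
      case 0
      then show ?thesis
        using 1
        by (auto intro!: derivative_eq_intros simp: flat_exp_def field_simps power2_eq_square)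
    next
      case (Suc j)
      then show ?thesis
        using 1
        by (auto intro!: derivative_eq_intros simp: flat_exp_def power_divide)
          (cases j; simp add: field_simps power2_eq_square)
    qed
    then show ?thesis
      by (rule has_field_derivative_transform_within_open[of _ _ _ "{0<..}"])
        (use 1 in \<open>auto simp: flat_exp_def\<close>)
  next
    case 2
    have "((\<lambda>t. 0) has_real_derivative 0) (at t)" by simp
    then have "(flat_exp m has_real_derivative 0) (at t)"
      by (rule has_field_derivative_transform_within_open[of _ _ _ "{..<0}"])
        (use 2 in \<open>auto simp: flat_exp_def\<close>)
    then show ?thesis using 2 by (simp add: flat_exp_def)
  next
    case 3
    \<comment> \<open>At \<open>0\<close> the difference quotient of \<open>flat_exp m\<close> is
      \<open>flat_exp (Suc m)\<close> itself, which tends to \<open>0\<close>.\<close>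
    have "((\<lambda>h. (flat_exp m (0 + h) - flat_exp m 0) / h) \<longlongrightarrow> 0) (at 0)"
    proof (rule Lim_transform_eventually[OF flat_exp_tendsto_0[of "Suc m"]])
      show "\<forall>\<^sub>F h in at 0. flat_exp (Suc m) h = (flat_exp m (0 + h) - flat_exp m 0) / h"
        by (rule always_eventually) (auto simp: flat_exp_def)
    qed
    then have "(flat_exp m has_real_derivative 0) (at 0)"
      by (simp add: DERIV_def)
    then show ?thesis using 3 by (simp add: flat_exp_def)
  qed
qed

lemma smooth_on_flat_exp: "smooth_on (flat_exp m) UNIV"
proof -
  have "Ck_on k (flat_exp m) UNIV" for k
  proof (induction k arbitrary: m)
    case 0
    then show ?case
      using DERIV_isCont[OF flat_exp_has_derivative[of m]]
      by (auto intro: continuous_at_imp_continuous_on)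
  next
    case (Suc k)
    have "Ck_on k (\<lambda>t. v *\<^sub>R (flat_exp (m + 2) t + (- real m) *\<^sub>R flat_exp (m + 1) t)) UNIV" for v
      by (intro Ck_on_scaleR Ck_on_add Ck_on_const Suc) auto
    then show ?case
      using flat_exp_has_derivative[of m]
      by (intro Ck_on_SucI[where f'="\<lambda>t v. v * (flat_exp (m + 2) t - m * flat_exp (m + 1) t)"])
        (auto simp: has_field_derivative_def mult_commute_abs)
  qed
  then show ?thesis by (simp add: smooth_on_def)
qed

lemma smooth_bump_exists:
  fixes a :: "'a::euclidean_space"
  assumes "r > 0"
  obtains \<psi> :: "'a \<Rightarrow> real"
    where "smooth_on \<psi> UNIV" "\<psi> a = 1" "\<And>x. x \<notin> cball a r \<Longrightarrow> \<psi> x = 0"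
proof
  \<comment> \<open>This is \<open>r\<^sup>2 - (dist a x)\<^sup>2\<close>, written with sums and
    products of affine functions so that its smoothness follows from the closure rules. It is
    negative outside \<open>cball a r\<close>, where \<open>flat_exp 0\<close> vanishes.\<close>
  define q where "q x = r\<^sup>2 + (\<Sum>i\<in>Basis. ((x - a) \<bullet> i) * ((a - x) \<bullet> i))" for x
  have q: "q x = r\<^sup>2 - (dist a x)\<^sup>2" for x
  proof -
    have "q x = r\<^sup>2 + (x - a) \<bullet> (a - x)"
      by (simp add: q_def euclidean_inner[of "x - a" "a - x"])
    also have "(x - a) \<bullet> (a - x) = - (dist a x)\<^sup>2"
      unfolding dist_norm power2_norm_eq_inner
      by (metis inner_minus_left minus_diff_eq)
    finally show ?thesis by simp
  qed
  have lin: "smooth_on (\<lambda>x::'a. (x - a) \<bullet> i) UNIV" "smooth_on (\<lambda>x::'a. (a - x) \<bullet> i) UNIV" for i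
    using smooth_on_add[OF open_UNIV smooth_on_ident[OF open_UNIV]
        smooth_on_const[OF open_UNIV, of "- a"]]
      smooth_on_add[OF open_UNIV smooth_on_const[OF open_UNIV, of "a"]
        smooth_on_bounded_linear[OF bounded_linear_minus[OF bounded_linear_ident] open_UNIV
          smooth_on_ident[OF open_UNIV]]]
    by (auto intro!: smooth_on_bounded_linear[OF bounded_linear_inner_left])
  have sq: "smooth_on q UNIV"
    unfolding q_def by (intro smooth_on_add smooth_on_const smooth_on_sum smooth_on_mult lin open_UNIV)
  have "smooth_on (\<lambda>x. flat_exp 0 (q x)) UNIV"
    by (rule smooth_on_compose[OF open_UNIV open_UNIV _ sq smooth_on_flat_exp]) auto
  then show "smooth_on (\<lambda>x. flat_exp 0 (q x) * (1 / flat_exp 0 (r\<^sup>2))) UNIV"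
    by (rule smooth_on_mult[OF open_UNIV _ smooth_on_const[OF open_UNIV]])
  show "flat_exp 0 (q a) * (1 / flat_exp 0 (r\<^sup>2)) = 1"
    using assms by (simp add: q flat_exp_def)
  show "flat_exp 0 (q x) * (1 / flat_exp 0 (r\<^sup>2)) = 0" if "x \<notin> cball a r" for x
  proof -
    have "r\<^sup>2 < (dist a x)\<^sup>2"
      using that assms by (intro power_strict_mono) auto
    then show ?thesis by (simp add: q flat_exp_def)
  qed
qed

subsection \<open>Hadamard's lemma\<close>

lemma segment_point_in:
  fixes a x :: "'a::real_vector"
  assumes "convex S" "a \<in> S" "x \<in> S" "0 \<le> t" "t \<le> 1"
  shows "a + t *\<^sub>R (x - a) \<in> S"
  using convexD_alt[OF assms] by (simp add: algebra_simps)

lemma continuous_on_slice: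
  assumes "continuous_on (S \<times> T) (\<lambda>(x, t). f x t)" "x \<in> S"
  shows "continuous_on T (f x)"
  using continuous_on_compose2[OF assms(1), of T "\<lambda>t. (x, t)"] assms(2)
  by (auto intro: continuous_on_Pair[OF continuous_on_const continuous_on_id, of T x, simplified])

lemma continuous_on_ray_integrand:
  fixes H :: "'a::euclidean_space \<Rightarrow> 'b::real_normed_vector"
  assumes "convex S" "a \<in> S" "continuous_on S H"
  shows "continuous_on (S \<times> {0..1}) (\<lambda>(x, t). t ^ m *\<^sub>R H (a + t *\<^sub>R (x - a)))"
proof -
  have "continuous_on (S \<times> {0..1}) (\<lambda>z. H (a + snd z *\<^sub>R (fst z - a)))"
    by (rule continuous_on_compose2[OF assms(3)])
      (auto intro!: continuous_intros segment_point_in assms)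
  then show ?thesis
    unfolding split_beta by (intro continuous_intros)
qed

text \<open>Differentiating under the integral sign produces one more factor \<open>t\<close> from
  the inner derivative of the ray. The weight \<open>t ^ m\<close> with arbitrary \<open>m\<close>
  makes the induction go through.\<close>

lemma Ck_on_ray_integral:
  fixes H :: "'a::euclidean_space \<Rightarrow> 'b::banach"
  assumes S: "open S" "convex S" "a \<in> S" and "Ck_on k H S"
  shows "Ck_on k (\<lambda>x. integral {0..1} (\<lambda>t. t ^ m *\<^sub>R H (a + t *\<^sub>R (x - a)))) S"
  using assms(4)
proof (induction k arbitrary: m H)
  case 0
  then have "continuous_on S H" by simp
  then show ?case
    using integral_continuous_on_param[of S 0 1 "\<lambda>x t. t ^ m *\<^sub>R H (a + t *\<^sub>R (x - a))"]
      continuous_on_ray_integrand[OF S(2,3), of H m]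
    by simp
next
  case (Suc k)
  note H = Ck_on_SucD[OF Suc.prems]
  \<comment> \<open>\<open>leibniz_rule\<close> asks for a derivative that is continuous as a map
    into the bounded linear operators. In finite dimension this follows from continuity on each
    basis vector.\<close>
  define B where "B y = Blinfun (frechet_derivative H (at y))" for y
  have B: "blinfun_apply (B y) = frechet_derivative H (at y)" if "y \<in> S" for y
    unfolding B_def by (rule bounded_linear_Blinfun_apply[OF has_derivative_bounded_linear[OF H(1)[OF that]]])
  have cB: "continuous_on S B"
  proof (rule continuous_on_blinfun_componentwise)
    fix i :: 'a
    have "continuous_on S (\<lambda>y. frechet_derivative H (at y) i)"
      using Ck_on_le[OF H(2)[of i], of 0] by simp
    then show "continuous_on S (\<lambda>y. blinfun_apply (B y) i)"
      by (rule continuous_on_eq) (simp add: B)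
  qed
  define fx where "fx x t = t ^ Suc m *\<^sub>R B (a + t *\<^sub>R (x - a))" for x and t :: real
  have cfx: "continuous_on (S \<times> {0..1}) (\<lambda>(x, t). fx x t)"
    unfolding fx_def by (rule continuous_on_ray_integrand[OF S(2,3) cB])
  have cH: "continuous_on S H"
    using Ck_on_le[OF Suc.prems, of 0] by simp
  have der: "((\<lambda>x. t ^ m *\<^sub>R H (a + t *\<^sub>R (x - a))) has_derivative blinfun_apply (fx x t))
      (at x within S)" if "x \<in> S" "t \<in> {0..1}" for x t
  proof -
    let ?y = "a + t *\<^sub>R (x - a)"
    have y: "?y \<in> S" using that S by (auto intro: segment_point_in)
    have 1: "((\<lambda>x. a + t *\<^sub>R (x - a)) has_derivative (\<lambda>v. t *\<^sub>R v)) (at x within S)"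
      by (auto intro!: derivative_eq_intros)
    have "((\<lambda>x. H (a + t *\<^sub>R (x - a))) has_derivative (\<lambda>v. blinfun_apply (B ?y) (t *\<^sub>R v)))
        (at x within S)"
      unfolding B[OF y] by (rule has_derivative_compose[OF 1 H(1)[OF y]])
    from has_derivative_scaleR_right[OF this, of "t ^ m"] show ?thesis
      by (simp add: fx_def scaleR_blinfun.rep_eq blinfun.scaleR_right mult.commute)
  qed
  have main: "((\<lambda>x. integral {0..1} (\<lambda>t. t ^ m *\<^sub>R H (a + t *\<^sub>R (x - a)))) has_derivative
      (\<lambda>v. integral {0..1} (\<lambda>t. t ^ Suc m *\<^sub>R frechet_derivative H (at (a + t *\<^sub>R (x - a))) v)))
      (at x)" if x: "x \<in> S" for x
  proof -
    have int: "fx x integrable_on {0..1}"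
      using continuous_on_slice[OF cfx x] by (rule integrable_continuous_interval)
    have "((\<lambda>x. integral (cbox 0 1) (\<lambda>t. t ^ m *\<^sub>R H (a + t *\<^sub>R (x - a)))) has_derivative
        blinfun_apply (integral (cbox 0 1) (fx x))) (at x within S)"
      using der cfx continuous_on_slice[OF continuous_on_ray_integrand[OF S(2,3) cH]]
      by (intro leibniz_rule x S(2)) (auto intro!: integrable_continuous_interval)
    moreover have "blinfun_apply (integral {0..1} (fx x)) =
        (\<lambda>v. integral {0..1} (\<lambda>t. t ^ Suc m *\<^sub>R frechet_derivative H (at (a + t *\<^sub>R (x - a))) v))"
    proof
      fix v
      show "blinfun_apply (integral {0..1} (fx x)) v =
          integral {0..1} (\<lambda>t. t ^ Suc m *\<^sub>R frechet_derivative H (at (a + t *\<^sub>R (x - a))) v)"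
        unfolding blinfun_apply_integral[OF int]
        by (rule integral_cong)
          (simp add: fx_def blinfun.scaleR_left B segment_point_in S x)
    qed
    ultimately show ?thesis
      unfolding at_within_open[OF x S(1)] cbox_interval[symmetric] by simp
  qed
  show ?case
    by (rule Ck_on_SucI[OF S(1) main Suc.IH[OF H(2)]])
qed

text \<open>Integrating the derivative of \<open>F\<close> along the segment from \<open>a\<close>
  to \<open>x\<close> gives \<open>F x - F a\<close>. Splitting \<open>x - a\<close> into
  coordinates makes \<open>h i x\<close> the mean of the \<open>i\<close>-th partial derivative over
  that segment; the factor \<open>t ^ 0\<close> gives it the shape of
  \<open>Ck_on_ray_integral\<close>.\<close>

lemma hadamard:
  fixes F :: "'a::euclidean_space \<Rightarrow> real"
  assumes S: "open S" "convex S" "a \<in> S" and F: "smooth_on F S"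
  obtains h where "\<And>i. smooth_on (h i) S"
    and "\<And>i. h i a = frechet_derivative F (at a) i"
    and "\<And>x. x \<in> S \<Longrightarrow> F x = F a + (\<Sum>i\<in>Basis. ((x - a) \<bullet> i) * h i x)"
proof
  define h where
    "h i x = integral {0..1} (\<lambda>t. t ^ 0 *\<^sub>R frechet_derivative F (at (a + t *\<^sub>R (x - a))) i)" for i x
  have sm: "smooth_on (\<lambda>x. frechet_derivative F (at x) i) S" for i
    by (rule smooth_on_frechet_derivative[OF F])
  show "smooth_on (h i) S" for i
    unfolding smooth_on_def h_def[abs_def]
    using Ck_on_ray_integral[OF S] sm[of i] unfolding smooth_on_def by blast
  show "h i a = frechet_derivative F (at a) i" for i
    by (simp add: h_def)
  show "F x = F a + (\<Sum>i\<in>Basis. ((x - a) \<bullet> i) * h i x)" if x: "x \<in> S" for x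
  proof -
    let ?y = "\<lambda>t. a + t *\<^sub>R (x - a)"
    have y: "?y t \<in> S" if "t \<in> {0..1}" for t
      using that x S by (auto intro: segment_point_in)
    have dF: "(F has_derivative frechet_derivative F (at z)) (at z)" if "z \<in> S" for z
      using smooth_on_differentiable[OF F that] frechet_derivative_works by blast
    have "((\<lambda>t. F (?y t)) has_vector_derivative frechet_derivative F (at (?y t)) (x - a))
        (at t within {0..1})" if "t \<in> {0..1}" for t
    proof -
      have 1: "(?y has_derivative (\<lambda>s. s *\<^sub>R (x - a))) (at t within {0..1})"
        by (auto intro!: derivative_eq_intros)
      show ?thesis
        using has_derivative_compose[OF 1 dF[OF y[OF that]]]
          linear_cmul[OF has_derivative_linear[OF dF[OF y[OF that]]]]
        by (simp add: has_vector_derivative_def)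
    qed
    then have "((\<lambda>t. frechet_derivative F (at (?y t)) (x - a)) has_integral F (?y 1) - F (?y 0)) {0..1}"
      by (intro fundamental_theorem_of_calculus) auto
    then have "F x - F a = integral {0..1} (\<lambda>t. frechet_derivative F (at (?y t)) (x - a))"
      by (simp add: integral_unique)
    also have "\<dots> = integral {0..1}
        (\<lambda>t. \<Sum>i\<in>Basis. ((x - a) \<bullet> i) * frechet_derivative F (at (?y t)) i)"
    proof (rule integral_cong)
      fix t :: real assume t: "t \<in> {0..1}"
      note l = has_derivative_linear[OF dF[OF y[OF t]]]
      show "frechet_derivative F (at (?y t)) (x - a)
          = (\<Sum>i\<in>Basis. ((x - a) \<bullet> i) * frechet_derivative F (at (?y t)) i)"
        by (subst (2) euclidean_representation[of "x - a", symmetric])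
          (simp add: linear_sum[OF l] linear_cmul[OF l])
    qed
    also have "\<dots> = (\<Sum>i\<in>Basis. ((x - a) \<bullet> i) * h i x)"
    proof -
      have "continuous_on {0..1} (\<lambda>t. frechet_derivative F (at (?y t)) i)" for i
        using y by (intro continuous_on_compose2[OF smooth_on_continuous_on[OF sm[of i]]])
          (auto intro!: continuous_intros)
      then have "(\<lambda>t. frechet_derivative F (at (?y t)) i) integrable_on {0..1}" for i
        by (rule integrable_continuous_interval)
      then show ?thesis
        by (subst integral_sum) (auto simp: h_def intro!: integrable_on_mult_right)
    qed
    finally show ?thesis by simp
  qed
qed

subsection \<open>Extension of tangent vectors to vector fields\<close>

lemma smooth_atlas_chart:
  assumes "smooth_atlas A" "(U, \<phi>) \<in> A"
  shows "open U" "open (\<phi> ` U)" "homeomorphism U (\<phi> ` U) \<phi> (inv_into U \<phi>)"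
  using assms unfolding smooth_atlas_def by fast+

lemma smooth_atlas_transition:
  assumes "smooth_atlas A" "(U, \<phi>) \<in> A" "(V, \<psi>) \<in> A"
  shows "smooth_on (\<lambda>x. \<psi> (inv_into U \<phi> x)) (\<phi> ` (U \<inter> V))"
  using assms unfolding smooth_atlas_def comp_def by fast

lemma smooth_atlas_cover:
  assumes "smooth_atlas A"
  obtains U \<phi> where "(U, \<phi>) \<in> A" "p \<in> U"
proof -
  have "p \<in> (\<Union>(U, \<phi>)\<in>A. U)"
    using assms by (simp add: smooth_atlas_def)
  then show ?thesis using that by auto
qed

section \<open>Smooth functions on a manifold\<close>

lemma smooth_fun_chart:
  "smooth_fun A f \<Longrightarrow> (U, \<phi>) \<in> A \<Longrightarrow> smooth_on (\<lambda>x. f (inv_into U \<phi> x)) (\<phi> ` U)"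
  unfolding smooth_fun_def comp_def by fast

lemma smooth_funI:
  "(\<And>U \<phi>. (U, \<phi>) \<in> A \<Longrightarrow> smooth_on (\<lambda>x. f (inv_into U \<phi> x)) (\<phi> ` U)) \<Longrightarrow> smooth_fun A f"
  unfolding smooth_fun_def comp_def by fast

lemma smooth_fun_const: "smooth_atlas A \<Longrightarrow> smooth_fun A (\<lambda>q. c)"
  by (intro smooth_funI smooth_on_const smooth_atlas_chart)

lemma smooth_fun_add:
  "smooth_atlas A \<Longrightarrow> smooth_fun A f \<Longrightarrow> smooth_fun A h \<Longrightarrow> smooth_fun A (\<lambda>q. f q + h q)"
  by (rule smooth_funI, rule smooth_on_add) (auto intro: smooth_atlas_chart smooth_fun_chart)

lemma smooth_fun_mult:
  "smooth_atlas A \<Longrightarrow> smooth_fun A f \<Longrightarrow> smooth_fun A h \<Longrightarrow> smooth_fun A (\<lambda>q. f q * h q)"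
  by (rule smooth_funI, rule smooth_on_mult) (auto intro: smooth_atlas_chart smooth_fun_chart)

lemma smooth_fun_diff:
  assumes "smooth_atlas A" "smooth_fun A f" "smooth_fun A h"
  shows "smooth_fun A (\<lambda>q. f q - h q)"
  using smooth_fun_add[OF assms(1,2) smooth_fun_mult[OF assms(1) smooth_fun_const[OF assms(1)] assms(3)],
      of "- 1"] by simp

lemma smooth_fun_sum:
  assumes "smooth_atlas A" "\<And>i. i \<in> I \<Longrightarrow> smooth_fun A (f i)"
  shows "smooth_fun A (\<lambda>q. \<Sum>i\<in>I. f i q)"
  using assms(2)
  by (induction I rule: infinite_finite_induct)
    (simp_all add: smooth_fun_const smooth_fun_add assms(1))

definition chart_lift :: "'m set \<Rightarrow> ('m \<Rightarrow> 'e) \<Rightarrow> ('e \<Rightarrow> real) \<Rightarrow> 'm \<Rightarrow> real" where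
  "chart_lift U \<phi> F q = (if q \<in> U then F (\<phi> q) else 0)"

text \<open>Any other chart domain is covered by two open sets. On \<open>W1\<close> the lift is
  \<open>F\<close> composed with a smooth transition map. On \<open>W2\<close> it is
  \<open>0\<close>; this set is open because the compact set corresponding to \<open>K\<close> is
  closed in a Hausdorff space.\<close>

lemma smooth_fun_chart_lift:
  fixes A :: "('m::{t2_space,second_countable_topology}, 'e::euclidean_space) atlas"
  assumes A: "smooth_atlas A" and U: "(U, \<phi>) \<in> A"
    and S: "open S" "compact K" "K \<subseteq> S" "S \<subseteq> \<phi> ` U"
    and F: "smooth_on F S" "\<And>x. x \<in> \<phi> ` U \<Longrightarrow> x \<notin> K \<Longrightarrow> F x = 0"
  shows "smooth_fun A (chart_lift U \<phi> F)"
proof (rule smooth_funI)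
  fix W \<psi> assume W: "(W, \<psi>) \<in> A"
  let ?i = "inv_into U \<phi>" and ?j = "inv_into W \<psi>"
  note cU = smooth_atlas_chart[OF A U] and cW = smooth_atlas_chart[OF A W]
  have inv: "q \<in> W \<Longrightarrow> ?j (\<psi> q) = q" "q \<in> U \<Longrightarrow> ?i (\<phi> q) = q" for q
    using cU(3) cW(3) by (auto simp: homeomorphism_def)
  \<comment> \<open>Such an image is the preimage of \<open>B\<close> under the continuous inverse
    chart.\<close>
  have img: "open (\<psi> ` B)" if "open B" "B \<subseteq> W" for B
  proof -
    have "\<psi> ` B = \<psi> ` W \<inter> ?j -` B"
      using that inv by force
    then show ?thesis
      using cW that by (simp add: continuous_open_preimage homeomorphism_cont2)
  qed
  define W1 where "W1 = W \<inter> (U \<inter> \<phi> -` S)"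
  define W2 where "W2 = W - ?i ` K"
  have "open (U \<inter> \<phi> -` S)"
    using cU S(1) by (intro continuous_open_preimage) (auto intro: homeomorphism_cont1)
  then have o1: "open (\<psi> ` W1)"
    using cW by (intro img) (auto simp: W1_def)
  have "compact (?i ` K)"
    using S by (intro compact_continuous_image continuous_on_subset[OF homeomorphism_cont2[OF cU(3)]]) auto
  then have o2: "open (\<psi> ` W2)"
    using cW by (intro img) (auto simp: W2_def intro: compact_imp_closed)
  have "W \<subseteq> W1 \<union> W2"
  proof
    fix q assume "q \<in> W"
    show "q \<in> W1 \<union> W2"
    proof (cases "q \<in> ?i ` K")
      case True
      then obtain k where k: "k \<in> K" "q = ?i k" by auto
      then obtain u where "u \<in> U" "k = \<phi> u" using S by auto
      then show ?thesis using k inv S \<open>q \<in> W\<close> by (auto simp: W1_def)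
    qed (use \<open>q \<in> W\<close> in \<open>auto simp: W2_def\<close>)
  qed
  then have un: "\<psi> ` W = \<psi> ` W1 \<union> \<psi> ` W2"
    by (auto simp: W1_def W2_def)
  have "smooth_on (\<lambda>x. F (\<phi> (?j x))) (\<psi> ` W1)"
  proof (rule smooth_on_compose[OF o1 S(1) _ _ F(1)])
    show "(\<lambda>x. \<phi> (?j x)) ` (\<psi> ` W1) \<subseteq> S"
      using inv by (auto simp: W1_def)
    show "smooth_on (\<lambda>x. \<phi> (?j x)) (\<psi> ` W1)"
      by (rule smooth_on_subset[OF smooth_atlas_transition[OF A W U]]) (auto simp: W1_def)
  qed
  then have s1: "smooth_on (\<lambda>x. chart_lift U \<phi> F (?j x)) (\<psi> ` W1)"
    by (rule smooth_on_cong[OF o1, rotated]) (auto simp: chart_lift_def W1_def inv)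
  have "chart_lift U \<phi> F q = 0" if "q \<in> W2" for q
  proof (cases "q \<in> U")
    case True
    then have "\<phi> q \<notin> K"
      using that inv(2)[OF True] by (metis DiffD2 W2_def image_eqI)
    then show ?thesis using True F(2) by (simp add: chart_lift_def)
  qed (simp add: chart_lift_def)
  then have s2: "smooth_on (\<lambda>x. chart_lift U \<phi> F (?j x)) (\<psi> ` W2)"
    by (intro smooth_on_cong[OF o2 _ smooth_on_const[OF o2]]) (auto simp: W2_def inv)
  show "smooth_on (\<lambda>x. chart_lift U \<phi> F (?j x)) (\<psi> ` W)"
    unfolding un by (rule smooth_on_Un[OF o1 o2 s1 s2])
qed

section \<open>Tangent vectors as derivations\<close>

lemma tangent_spaceD:
  assumes "v \<in> tangent_space A p"
  shows "smooth_fun A f \<Longrightarrow> smooth_fun A h \<Longrightarrow> v (\<lambda>q. f q + h q) = v f + v h"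
    and "smooth_fun A f \<Longrightarrow> smooth_fun A h \<Longrightarrow> v (\<lambda>q. f q * h q) = f p * v h + h p * v f"
    and "smooth_fun A f \<Longrightarrow> v (\<lambda>q. c * f q) = c * v f"
    and "\<not> smooth_fun A f \<Longrightarrow> v f = 0"
  using assms unfolding tangent_space_def by blast+

text \<open>The product rule for \<open>1 = 1 * 1\<close> gives
  \<open>v 1 = 2 * v 1\<close>.\<close>

lemma tangent_const:
  assumes "smooth_atlas A" "v \<in> tangent_space A p"
  shows "v (\<lambda>q. c) = 0"
proof -
  have "v (\<lambda>q. 1) = 0"
    using tangent_spaceD(2)[OF assms(2) smooth_fun_const smooth_fun_const, of 1 1] assms(1) by simp
  then show ?thesis
    using tangent_spaceD(3)[OF assms(2) smooth_fun_const[OF assms(1)], of c 1] by simp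
qed

lemma tangent_sum:
  assumes "smooth_atlas A" "v \<in> tangent_space A p" "\<And>i. i \<in> I \<Longrightarrow> smooth_fun A (f i)"
  shows "v (\<lambda>q. \<Sum>i\<in>I. f i q) = (\<Sum>i\<in>I. v (f i))"
  using assms(3)
proof (induction I rule: infinite_finite_induct)
  case (insert i I)
  then show ?case
    using tangent_spaceD(1)[OF assms(2), of "f i" "\<lambda>q. \<Sum>i\<in>I. f i q"]
    by (simp add: smooth_fun_sum assms(1))
qed (simp_all add: tangent_const[OF assms(1,2)])

text \<open>In a chart around \<open>p\<close>, Hadamard's lemma writes a smooth function as a constant plus a sum of
  products of the coordinates, which vanish at \<open>p\<close>, with smooth functions; hence a derivation is
  the directional derivative in the vector of its values on the coordinates. The bump \<open>\<psi>\<close> makes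
  everything globally defined; only \<open>\<psi> a = 1\<close> at the centre is needed, since
  \<open>(1 - \<beta>\<^sup>2) (f - f p)\<close> is a product of two functions vanishing at \<open>p\<close>.\<close>

lemma vector_field_extension:
  fixes A :: "('m::{t2_space,second_countable_topology}, 'e::euclidean_space) atlas"
  assumes A: "smooth_atlas A" and v: "v \<in> tangent_space A p"
  obtains X where "X \<in> vector_fields A" "X p = v"
proof -
  obtain U \<phi> where U: "(U, \<phi>) \<in> A" and p: "p \<in> U"
    using smooth_atlas_cover[OF A] by metis
  note cU = smooth_atlas_chart[OF A U]
  have inv: "q \<in> U \<Longrightarrow> inv_into U \<phi> (\<phi> q) = q" for q
    using cU(3) by (auto simp: homeomorphism_def)
  define a where "a = \<phi> p"
  have "a \<in> \<phi> ` U" using p by (simp add: a_def)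
  then obtain R where R: "R > 0" "ball a R \<subseteq> \<phi> ` U"
    using cU(2) openE by blast
  define S where "S = ball a R"
  define K where "K = cball a (R / 2)"
  have S: "open S" "convex S" "a \<in> S" "compact K" "K \<subseteq> S" "S \<subseteq> \<phi> ` U"
    using R by (auto simp: S_def K_def)
  obtain \<psi> :: "'e \<Rightarrow> real" where \<psi>: "smooth_on \<psi> UNIV" "\<psi> a = 1" "\<And>x. x \<notin> K \<Longrightarrow> \<psi> x = 0"
    using smooth_bump_exists[of "R / 2" a] R(1) unfolding K_def by auto
  have lift: "smooth_fun A (chart_lift U \<phi> (\<lambda>x. \<psi> x * F x))" if "smooth_on F S" for F
    using \<psi> that
    by (intro smooth_fun_chart_lift[OF A U S(1,4-6)] smooth_on_mult S(1))
      (auto intro: smooth_on_subset)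
  define \<gamma> where "\<gamma> i = chart_lift U \<phi> (\<lambda>x. \<psi> x * ((x - a) \<bullet> i))" for i
  define \<beta> where "\<beta> = chart_lift U \<phi> (\<lambda>x. \<psi> x * 1)"
  have "smooth_on (\<lambda>x. (x + (- a)) \<bullet> i) S" for i
    by (intro smooth_on_bounded_linear[OF bounded_linear_inner_left] smooth_on_add
        smooth_on_ident smooth_on_const S(1))
  then have \<gamma>: "smooth_fun A (\<gamma> i)" for i
    unfolding \<gamma>_def by (intro lift) simp
  have \<beta>: "smooth_fun A \<beta>"
    unfolding \<beta>_def by (intro lift smooth_on_const S(1))
  \<comment> \<open>The components of \<open>v\<close> in the chart: its values on the coordinates
    centred at \<open>a\<close> and cut off by the bump.\<close>
  define w where "w = (\<Sum>i\<in>Basis. v (\<gamma> i) *\<^sub>R i)"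
  define loc where "loc f x = f (inv_into U \<phi> x)" for f :: "'m \<Rightarrow> real" and x
  have loc: "smooth_on (loc f) (\<phi> ` U)" if "smooth_fun A f" for f
    using smooth_fun_chart[OF that U] by (simp add: loc_def[abs_def])
  have dloc: "(loc f has_derivative frechet_derivative (loc f) (at x)) (at x)"
    if "smooth_fun A f" "x \<in> \<phi> ` U" for f x
    using smooth_on_differentiable[OF loc[OF that(1)] that(2)] frechet_derivative_works by blast
  \<comment> \<open>The constant field \<open>w\<close> of the chart, multiplied by the bump. The
    value \<open>0\<close> on functions that are not smooth is the convention of
    \<open>tangent_space\<close>.\<close>
  define X where "X q f = (if smooth_fun A f
      then chart_lift U \<phi> (\<lambda>x. \<psi> x * frechet_derivative (loc f) (at x) w) q else 0)" for q f
  have "X q \<in> tangent_space A q" for q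
  proof (cases "q \<in> U")
    case True
    let ?d = "\<lambda>f. frechet_derivative (loc f) (at (\<phi> q))"
    have q: "\<phi> q \<in> \<phi> ` U" using True by simp
    have [simp]: "loc f (\<phi> q) = f q" for f
      using inv[OF True] by (simp add: loc_def)
    have [simp]: "?d (\<lambda>q. f q + h q) w = ?d f w + ?d h w"
      and [simp]: "?d (\<lambda>q. f q * h q) w = f q * ?d h w + h q * ?d f w"
      if "smooth_fun A f" "smooth_fun A h" for f h
    proof -
      note d = dloc[OF that(1) q] dloc[OF that(2) q]
      show "?d (\<lambda>q. f q + h q) w = ?d f w + ?d h w"
        using frechet_derivative_at[OF has_derivative_add[OF d]]
        by (simp add: loc_def[abs_def] fun_eq_iff)
      show "?d (\<lambda>q. f q * h q) w = f q * ?d h w + h q * ?d f w"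
        using fun_cong[OF frechet_derivative_at[OF has_derivative_mult[OF d]], of w, symmetric] inv[OF True]
        by (simp add: loc_def[abs_def] mult.commute)
    qed
    \<comment> \<open>Homogeneity is then the product rule with a constant factor.\<close>
    have [simp]: "?d (\<lambda>q. c) w = 0" for c
      by (simp add: loc_def[abs_def])
    show ?thesis
      using True
      by (simp add: tangent_space_def X_def chart_lift_def smooth_fun_add smooth_fun_mult
          smooth_fun_const A algebra_simps)
  next
    case False
    then show ?thesis by (simp add: tangent_space_def X_def chart_lift_def)
  qed
  moreover have "smooth_fun A (\<lambda>q. X q f)" if f: "smooth_fun A f" for f
  proof -
    have "smooth_on (\<lambda>x. frechet_derivative (loc f) (at x) w) S"
      using smooth_on_subset[OF smooth_on_frechet_derivative[OF loc[OF f]] S(6)] .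
    from lift[OF this] show ?thesis by (simp add: X_def f)
  qed
  ultimately have "X \<in> vector_fields A"
    by (simp add: vector_fields_def)
  moreover have "X p = v"
  proof
    fix f
    show "X p f = v f"
    proof (cases "smooth_fun A f")
      case f: True
      obtain h where h: "\<And>i. smooth_on (h i) S" "\<And>i. h i a = frechet_derivative (loc f) (at a) i"
        "\<And>x. x \<in> S \<Longrightarrow> loc f x = loc f a + (\<Sum>i\<in>Basis. ((x - a) \<bullet> i) * h i x)"
        using hadamard[OF S(1-3) smooth_on_subset[OF loc[OF f] S(6)]] by metis
      define H where "H i = chart_lift U \<phi> (\<lambda>x. \<psi> x * h i x)" for i
      have H: "smooth_fun A (H i)" for i
        unfolding H_def by (intro lift h)
      define \<kappa> where "\<kappa> q = 1 - \<beta> q * \<beta> q" for q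
      have \<kappa>: "smooth_fun A \<kappa>"
        unfolding \<kappa>_def[abs_def] by (intro smooth_fun_diff smooth_fun_const smooth_fun_mult A \<beta>)
      define f0 where "f0 q = f q - f p" for q
      have f0: "smooth_fun A f0"
        unfolding f0_def[abs_def] by (intro smooth_fun_diff smooth_fun_const A f)
      have sum: "smooth_fun A (\<lambda>q. \<Sum>i\<in>Basis. \<gamma> i q * H i q)"
        by (intro smooth_fun_sum smooth_fun_mult A \<gamma> H)
      have at_p: "f0 p = 0" "\<kappa> p = 0" "\<gamma> i p = 0" "H i p = frechet_derivative (loc f) (at a) i" for i
        using p \<psi>(2) by (auto simp: f0_def \<kappa>_def \<beta>_def \<gamma>_def H_def chart_lift_def a_def[symmetric] h)
      \<comment> \<open>Split \<open>f0\<close> into \<open>\<kappa> * f0\<close> and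
        \<open>\<beta> * \<beta> * f0\<close>. Hadamard's lemma rewrites the second part, with one
        bump factor absorbed in \<open>\<gamma> i\<close> and the other in \<open>H i\<close>. Where
        the bump vanishes, \<open>\<kappa>\<close> is \<open>1\<close> and the sum is
        \<open>0\<close>.\<close>
      have "f q = f p + (\<kappa> q * f0 q + (\<Sum>i\<in>Basis. \<gamma> i q * H i q))" for q
      proof (cases "q \<in> U \<and> \<phi> q \<in> S")
        case True
        have "f q = f p + (\<Sum>i\<in>Basis. ((\<phi> q - a) \<bullet> i) * h i (\<phi> q))"
          using h(3)[of "\<phi> q"] True inv p by (simp add: loc_def a_def)
        then have e: "f0 q = (\<Sum>i\<in>Basis. ((\<phi> q - a) \<bullet> i) * h i (\<phi> q))"
          by (simp add: f0_def)
        have "(\<Sum>i\<in>Basis. \<gamma> i q * H i q) = \<beta> q * \<beta> q * f0 q"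
          using True unfolding e by (simp add: \<gamma>_def H_def \<beta>_def chart_lift_def sum_distrib_left mult_ac)
        then show ?thesis by (simp add: \<kappa>_def f0_def algebra_simps)
      next
        case False
        then have "\<beta> q = 0" "\<gamma> i q = 0" for i
          using \<psi>(3) S(5) by (auto simp: \<beta>_def \<gamma>_def chart_lift_def)
        then show ?thesis by (simp add: \<kappa>_def f0_def)
      qed
      then have "v f = v (\<lambda>q. f p + (\<kappa> q * f0 q + (\<Sum>i\<in>Basis. \<gamma> i q * H i q)))"
        by (metis ext)
      also have "\<dots> = v (\<lambda>q. \<kappa> q * f0 q) + (\<Sum>i\<in>Basis. v (\<lambda>q. \<gamma> i q * H i q))"
        using tangent_spaceD(1)[OF v smooth_fun_const[OF A]
            smooth_fun_add[OF A smooth_fun_mult[OF A \<kappa> f0] sum]]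
          tangent_spaceD(1)[OF v smooth_fun_mult[OF A \<kappa> f0] sum]
          tangent_sum[OF A v smooth_fun_mult[OF A \<gamma> H]]
        by (simp add: tangent_const[OF A v])
      also have "\<dots> = (\<Sum>i\<in>Basis. v (\<gamma> i) * frechet_derivative (loc f) (at a) i)"
        using tangent_spaceD(2)[OF v \<kappa> f0] tangent_spaceD(2)[OF v \<gamma> H]
        by (simp add: at_p mult.commute)
      also have "\<dots> = frechet_derivative (loc f) (at a) w"
      proof -
        have "linear (frechet_derivative (loc f) (at a))"
          using dloc[OF f] S(3,6) has_derivative_linear by blast
        then show ?thesis by (simp add: w_def linear_sum linear_cmul)
      qed
      also have "\<dots> = X p f"
        using f p \<psi>(2) by (simp add: X_def chart_lift_def a_def)
      finally show ?thesis ..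
    qed (use tangent_spaceD(4)[OF v] in \<open>simp add: X_def\<close>)
  qed
  ultimately show ?thesis using that by blast
qed

lemma extension:
  assumes "smooth_atlas A" "x \<in> tangent_space A p"
  shows "extension A p x \<in> vector_fields A" "extension A p x p = x"
proof -
  have "\<exists>X. X \<in> vector_fields A \<and> X p = x"
    using vector_field_extension[OF assms] by blast
  from someI_ex[OF this] show "extension A p x \<in> vector_fields A" "extension A p x p = x"
    by (simp_all add: extension_def)
qed

subsection \<open>Riemannian manifolds\<close>

lemma vector_fieldD:
  assumes "X \<in> vector_fields A"
  shows "X p \<in> tangent_space A p" "smooth_fun A f \<Longrightarrow> smooth_fun A (\<lambda>p. X p f)"
  using assms by (auto simp: vector_fields_def)

lemma tangent_space_add:
  "v \<in> tangent_space A p \<Longrightarrow> w \<in> tangent_space A p \<Longrightarrow> v + w \<in> tangent_space A p"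
  by (simp add: tangent_space_def algebra_simps)

lemma tangent_space_tscale: "v \<in> tangent_space A p \<Longrightarrow> tscale c v \<in> tangent_space A p"
  by (simp add: tangent_space_def tscale_def algebra_simps)

lemma vector_fields_add:
  assumes "smooth_atlas A" "X \<in> vector_fields A" "Y \<in> vector_fields A"
  shows "X + Y \<in> vector_fields A"
  using assms by (simp add: vector_fields_def tangent_space_add smooth_fun_add)

lemma vector_fields_fscale:
  assumes "smooth_atlas A" "smooth_fun A f" "X \<in> vector_fields A"
  shows "fscale f X \<in> vector_fields A"
  using assms
  by (simp add: vector_fields_def fscale_def tangent_space_tscale) (simp add: tscale_def smooth_fun_mult)

lemma vector_fields_uminus:
  assumes "smooth_atlas A" "X \<in> vector_fields A"
  shows "- X \<in> vector_fields A"
proof -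
  have "- X = fscale (\<lambda>_. - 1) X"
    by (simp add: fun_eq_iff fscale_def tscale_def)
  then show ?thesis
    using vector_fields_fscale[OF assms(1) smooth_fun_const[OF assms(1)] assms(2)] by simp
qed

lemma vector_fields_diff:
  assumes "smooth_atlas A" "X \<in> vector_fields A" "Y \<in> vector_fields A"
  shows "X - Y \<in> vector_fields A"
  using vector_fields_add[OF assms(1,2) vector_fields_uminus[OF assms(1,3)]] by simp

lemma vector_fields_zero: "smooth_atlas A \<Longrightarrow> 0 \<in> vector_fields A"
  by (simp add: vector_fields_def tangent_space_def smooth_fun_const)

locale riemannian_manifold =
  fixes A :: "('m::{t2_space,second_countable_topology}, 'e::euclidean_space) atlas"
    and g :: "'m \<Rightarrow> 'm tvec \<Rightarrow> 'm tvec \<Rightarrow> real"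
    and D :: "'m vfield \<Rightarrow> 'm vfield \<Rightarrow> 'm vfield"
  assumes atlas: "smooth_atlas A" and metric: "riemannian_metric A g" and lc: "levi_civita A g D"
begin

abbreviation "VF \<equiv> vector_fields A"

text \<open>As a function of the point, the inner product of two fields can itself be differentiated
  by a vector field.\<close>

definition pairing :: "'m vfield \<Rightarrow> 'm vfield \<Rightarrow> 'm \<Rightarrow> real" where
  "pairing X Y p = g p (X p) (Y p)"

lemma metric_add: "x \<in> tangent_space A p \<Longrightarrow> y \<in> tangent_space A p \<Longrightarrow> z \<in> tangent_space A p
    \<Longrightarrow> g p (x + y) z = g p x z + g p y z"
  and metric_tscale: "x \<in> tangent_space A p \<Longrightarrow> z \<in> tangent_space A p
    \<Longrightarrow> g p (tscale c x) z = c * g p x z"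
  and metric_sym: "x \<in> tangent_space A p \<Longrightarrow> y \<in> tangent_space A p \<Longrightarrow> g p x y = g p y x"
  and metric_pos: "x \<in> tangent_space A p \<Longrightarrow> x \<noteq> 0 \<Longrightarrow> g p x x > 0"
  using metric unfolding riemannian_metric_def by blast+

lemmas VF_closed [simp] =
  vector_fields_add[OF atlas] vector_fields_diff[OF atlas] vector_fields_uminus[OF atlas]
  vector_fields_fscale[OF atlas] vector_fields_zero[OF atlas]

lemma D_closed [simp]: "X \<in> VF \<Longrightarrow> Y \<in> VF \<Longrightarrow> D X Y \<in> VF"
  using lc unfolding levi_civita_def affine_connection_def by blast

lemma torsion_free: "X \<in> VF \<Longrightarrow> Y \<in> VF \<Longrightarrow> lie_bracket X Y = D X Y - D Y X"
  using lc unfolding levi_civita_def by metis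

lemma lie_bracket_closed [simp]: "X \<in> VF \<Longrightarrow> Y \<in> VF \<Longrightarrow> lie_bracket X Y \<in> VF"
  by (simp add: torsion_free)

lemma smooth_pairing [simp]: "X \<in> VF \<Longrightarrow> Y \<in> VF \<Longrightarrow> smooth_fun A (pairing X Y)"
  using metric unfolding riemannian_metric_def pairing_def[abs_def] by blast

lemma pairing_sym: "X \<in> VF \<Longrightarrow> Y \<in> VF \<Longrightarrow> pairing X Y p = pairing Y X p"
  by (simp add: pairing_def metric_sym vector_fieldD)

lemma pairing_add_left:
  "X \<in> VF \<Longrightarrow> Y \<in> VF \<Longrightarrow> Z \<in> VF \<Longrightarrow> pairing (X + Y) Z p = pairing X Z p + pairing Y Z p"
  by (simp add: pairing_def metric_add vector_fieldD)

lemma pairing_fscale_left: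
  "X \<in> VF \<Longrightarrow> Z \<in> VF \<Longrightarrow> pairing (fscale f X) Z p = f p * pairing X Z p"
  by (simp add: pairing_def fscale_def metric_tscale vector_fieldD)

lemma pairing_diff_left:
  assumes "X \<in> VF" "Y \<in> VF" "Z \<in> VF"
  shows "pairing (X - Y) Z p = pairing X Z p - pairing Y Z p"
  using pairing_add_left[of "X - Y" Y Z p] assms by simp

lemma pairing_uminus_left:
  assumes "X \<in> VF" "Z \<in> VF"
  shows "pairing (- X) Z p = - pairing X Z p"
  using pairing_diff_left[of 0 0 Z p] pairing_diff_left[of 0 X Z p] assms by simp

lemmas pairing_left = pairing_add_left pairing_fscale_left pairing_diff_left pairing_uminus_left

lemma pairing_right:
  assumes "X \<in> VF" "Y \<in> VF" "Z \<in> VF"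
  shows "pairing Z (X + Y) p = pairing Z X p + pairing Z Y p"
    and "pairing Z (X - Y) p = pairing Z X p - pairing Z Y p"
    and "pairing Z (- X) p = - pairing Z X p"
  using assms by (simp_all add: pairing_sym[of Z] pairing_left)

lemma compatible:
  "X \<in> VF \<Longrightarrow> Y \<in> VF \<Longrightarrow> Z \<in> VF \<Longrightarrow> X p (pairing Y Z) = pairing (D X Y) Z p + pairing Y (D X Z) p"
  using lc unfolding levi_civita_def pairing_def[abs_def] by blast

lemma D_add_left: "X \<in> VF \<Longrightarrow> Y \<in> VF \<Longrightarrow> Z \<in> VF \<Longrightarrow> D (X + Y) Z = D X Z + D Y Z"
  and D_add_right: "X \<in> VF \<Longrightarrow> Y \<in> VF \<Longrightarrow> Z \<in> VF \<Longrightarrow> D X (Y + Z) = D X Y + D X Z"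
  and D_fscale_right: "X \<in> VF \<Longrightarrow> Y \<in> VF \<Longrightarrow> smooth_fun A f \<Longrightarrow>
    D X (fscale f Y) = fscale (\<lambda>p. X p f) Y + fscale f (D X Y)"
  using lc unfolding levi_civita_def affine_connection_def by blast+

lemma D_diff_left: "X \<in> VF \<Longrightarrow> Y \<in> VF \<Longrightarrow> Z \<in> VF \<Longrightarrow> D (X - Y) Z = D X Z - D Y Z"
  using D_add_left[of "X - Y" Y Z] by (simp add: algebra_simps)

lemma D_diff_right: "X \<in> VF \<Longrightarrow> Y \<in> VF \<Longrightarrow> Z \<in> VF \<Longrightarrow> D X (Y - Z) = D X Y - D X Z"
  using D_add_right[of X "Y - Z" Z] by (simp add: algebra_simps)

lemma D_uminus_right: "X \<in> VF \<Longrightarrow> Y \<in> VF \<Longrightarrow> D X (- Y) = - D X Y"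
  using D_diff_right[of X 0 0] D_diff_right[of X 0 Y] by simp

lemmas derivation_add = tangent_spaceD(1)[OF vector_fieldD(1)]
lemmas derivation_mult = tangent_spaceD(2)[OF vector_fieldD(1)]

lemma derivation_uminus: "X \<in> VF \<Longrightarrow> smooth_fun A f \<Longrightarrow> X p (\<lambda>q. - f q) = - X p f"
  using tangent_spaceD(3)[OF vector_fieldD(1), of X A f p "- 1"] by simp

section \<open>Curvature\<close>

lemma curvature_closed [simp]: "X \<in> VF \<Longrightarrow> Y \<in> VF \<Longrightarrow> Z \<in> VF \<Longrightarrow> curvature D X Y Z \<in> VF"
  by (simp add: curvature_def)

lemma second_derivative_pairing:
  assumes "X \<in> VF" "Y \<in> VF" "Z \<in> VF" "W \<in> VF"
  shows "X p (\<lambda>q. Y q (pairing Z W)) =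
    pairing (D X (D Y Z)) W p + pairing (D Y Z) (D X W) p
    + (pairing (D X Z) (D Y W) p + pairing Z (D X (D Y W)) p)"
  using derivation_add[of X A "pairing (D Y Z) W" "pairing Z (D Y W)" p] assms
  by (simp add: compatible)

text \<open>Apply \<open>X Y - Y X - [X, Y]\<close>, which annihilates functions, to
  \<open>pairing Z W\<close>. The mixed first-derivative terms are symmetric in \<open>X\<close> and
  \<open>Y\<close> and cancel.\<close>

lemma curvature_skew:
  assumes "X \<in> VF" "Y \<in> VF" "Z \<in> VF" "W \<in> VF"
  shows "pairing (curvature D X Y Z) W p = - pairing (curvature D X Y W) Z p"
proof -
  have "lie_bracket X Y p (pairing Z W) = X p (\<lambda>q. Y q (pairing Z W)) - Y p (\<lambda>q. X q (pairing Z W))"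
    by (simp add: lie_bracket_def)
  also note second_derivative_pairing[OF assms]
  also note second_derivative_pairing[OF assms(2,1,3,4)]
  finally have "pairing (curvature D X Y Z) W p = - pairing Z (curvature D X Y W) p"
    using assms by (simp add: curvature_def pairing_left pairing_right compatible)
  then show ?thesis using assms by (simp add: pairing_sym)
qed

text \<open>Skew-symmetry moves \<open>Z\<close> into the metric, where only its value at
  \<open>p\<close> counts. This reconciles the extension of \<open>\<theta> p x\<close> chosen in
  \<open>riemann_at\<close> with the field \<open>T X\<close>.\<close>

lemma curvature_tensorial:
  assumes "X \<in> VF" "Y \<in> VF" "Z \<in> VF" "Z' \<in> VF" "W \<in> VF" "Z p = Z' p"
  shows "pairing (curvature D X Y Z) W p = pairing (curvature D X Y Z') W p"
  using assms curvature_skew[of X Y Z W p] curvature_skew[of X Y Z' W p] by (simp add: pairing_def)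

end

subsection \<open>Nearly cosymplectic manifolds\<close>

locale nearly_cosymplectic_manifold = riemannian_manifold A g D
  for A :: "('m::{t2_space,second_countable_topology}, 'e::euclidean_space) atlas"
    and g :: "'m \<Rightarrow> 'm tvec \<Rightarrow> 'm tvec \<Rightarrow> real"
    and D :: "'m vfield \<Rightarrow> 'm vfield \<Rightarrow> 'm vfield" +
  fixes \<theta> :: "'m \<Rightarrow> 'm tvec \<Rightarrow> 'm tvec"
    and \<xi> :: "'m vfield"
    and \<eta> :: "'m \<Rightarrow> 'm tvec \<Rightarrow> real"
  assumes nc: "nearly_cosymplectic A \<theta> \<xi> \<eta> g D"
begin

lemma almost_contact:
  shows "tensor_11 A \<theta>" and xi_VF [simp]: "\<xi> \<in> VF" and "metric_norm g p (\<xi> p) = 1"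
    and theta_theta: "x \<in> tangent_space A p \<Longrightarrow> \<theta> p (\<theta> p x) = - x + tscale (\<eta> p x) (\<xi> p)"
    and eta_xi: "\<eta> p (\<xi> p) = 1"
    and theta_isometry: "x \<in> tangent_space A p \<Longrightarrow> y \<in> tangent_space A p \<Longrightarrow>
      g p (\<theta> p x) (\<theta> p y) = g p x y - \<eta> p x * \<eta> p y"
    and eta_linear: "x \<in> tangent_space A p \<Longrightarrow> y \<in> tangent_space A p \<Longrightarrow> \<eta> p (x + y) = \<eta> p x + \<eta> p y"
    "x \<in> tangent_space A p \<Longrightarrow> \<eta> p (tscale c x) = c * \<eta> p x"
  using nc unfolding nearly_cosymplectic_def almost_contact_metric_def one_form_def by blast+

lemma theta_closed: "x \<in> tangent_space A p \<Longrightarrow> \<theta> p x \<in> tangent_space A p"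
  and theta_add: "x \<in> tangent_space A p \<Longrightarrow> y \<in> tangent_space A p \<Longrightarrow> \<theta> p (x + y) = \<theta> p x + \<theta> p y"
  and theta_tscale: "x \<in> tangent_space A p \<Longrightarrow> \<theta> p (tscale c x) = tscale c (\<theta> p x)"
  using almost_contact(1) unfolding tensor_11_def by blast+

abbreviation "T \<equiv> apply_tensor \<theta>"

lemma T_closed [simp]: "X \<in> VF \<Longrightarrow> T X \<in> VF"
  using almost_contact(1) unfolding tensor_11_def by blast

section \<open>Algebra of the almost contact metric structure\<close>

lemma xi_tangent: "\<xi> p \<in> tangent_space A p"
  by (simp add: vector_fieldD)

lemma pairing_xi_xi: "pairing \<xi> \<xi> p = 1"
  using almost_contact(3)[of p] by (simp add: pairing_def metric_norm_def)

text \<open>Compatibility gives \<open>\<theta> \<xi>\<close> the squared length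
  \<open>1 - 1 = 0\<close>, so it vanishes by positive definiteness.\<close>

lemma theta_xi: "\<theta> p (\<xi> p) = 0"
proof (rule ccontr)
  assume "\<theta> p (\<xi> p) \<noteq> 0"
  then have "g p (\<theta> p (\<xi> p)) (\<theta> p (\<xi> p)) > 0"
    by (intro metric_pos theta_closed xi_tangent)
  then show False
    using theta_isometry[OF xi_tangent xi_tangent, of p] pairing_xi_xi[of p]
    by (simp add: pairing_def eta_xi)
qed

lemma metric_zero: "x \<in> tangent_space A p \<Longrightarrow> g p 0 x = 0"
  using metric_tscale[of x p x 0] by (simp add: tscale_def zero_fun_def)

lemma eta_eq: "x \<in> tangent_space A p \<Longrightarrow> \<eta> p x = g p (\<xi> p) x"
  using theta_isometry[OF xi_tangent, of x p] by (simp add: theta_xi eta_xi metric_zero theta_closed)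

text \<open>Compute the cube of \<open>\<theta>\<close> in two ways: as \<open>\<theta>\<close> of
  the square it is \<open>- \<theta> x\<close>, because \<open>\<theta> \<xi> = 0\<close>; as the
  square at \<open>\<theta> x\<close> it has the extra term
  \<open>\<eta> (\<theta> x) \<xi>\<close>.\<close>

lemma eta_theta:
  assumes "x \<in> tangent_space A p"
  shows "\<eta> p (\<theta> p x) = 0"
proof -
  note x = assms theta_closed[OF assms] xi_tangent[of p]
  have "- x = tscale (- 1) x" "- \<theta> p x = tscale (- 1) (\<theta> p x)"
    by (auto simp: fun_eq_iff tscale_def)
  then have "\<theta> p (\<theta> p (\<theta> p x)) = - \<theta> p x"
    using x by (simp add: theta_theta[OF x(1)] theta_add theta_tscale tangent_space_tscale theta_xi)
      (simp add: tscale_def fun_eq_iff)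
  then have "tscale (\<eta> p (\<theta> p x)) (\<xi> p) = tscale 0 (\<xi> p)"
    using theta_theta[OF x(2)] by (simp add: tscale_def fun_eq_iff)
  then have "\<eta> p (tscale (\<eta> p (\<theta> p x)) (\<xi> p)) = \<eta> p (tscale 0 (\<xi> p))"
    by simp
  then show ?thesis
    by (simp add: eta_linear x eta_xi)
qed

text \<open>Writing \<open>\<eta>\<close> as \<open>pairing \<xi> X\<close> makes the coefficient a
  smooth function that \<open>compatible\<close> can differentiate.\<close>

lemma T_T: "X \<in> VF \<Longrightarrow> T (T X) = - X + fscale (pairing \<xi> X) \<xi>"
  by (simp add: fun_eq_iff apply_tensor_def fscale_def pairing_def theta_theta eta_eq vector_fieldD)

lemma pairing_xi_T: "X \<in> VF \<Longrightarrow> pairing \<xi> (T X) p = 0"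
  using eta_theta[of "X p" p] eta_eq[of "\<theta> p (X p)" p]
  by (simp add: pairing_def apply_tensor_def vector_fieldD theta_closed)

lemma pairing_T_T: "X \<in> VF \<Longrightarrow> Y \<in> VF \<Longrightarrow>
    pairing (T X) (T Y) p = pairing X Y p - pairing \<xi> X p * pairing \<xi> Y p"
  by (simp add: pairing_def apply_tensor_def theta_isometry eta_eq vector_fieldD)

lemma T_add: "X \<in> VF \<Longrightarrow> Y \<in> VF \<Longrightarrow> T (X + Y) = T X + T Y"
  by (simp add: fun_eq_iff apply_tensor_def theta_add vector_fieldD)

lemma T_diff: "X \<in> VF \<Longrightarrow> Y \<in> VF \<Longrightarrow> T (X - Y) = T X - T Y"
  using T_add[of "X - Y" Y] by (simp add: algebra_simps)

text \<open>Compatibility for \<open>T X\<close> and \<open>Y\<close>, where both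
  \<open>\<eta>\<close> terms drop out because the image of \<open>\<theta>\<close> is orthogonal to
  \<open>\<xi>\<close>.\<close>

lemma T_skew:
  assumes "X \<in> VF" "Y \<in> VF"
  shows "pairing (T X) Y p = - pairing X (T Y) p"
  using pairing_T_T[of "T X" Y p] assms
  by (simp add: T_T pairing_left pairing_xi_T)

section \<open>The covariant derivative of the structure tensor\<close>

abbreviation "N \<equiv> tensor_deriv D \<theta>"

lemma N_closed [simp]: "X \<in> VF \<Longrightarrow> Y \<in> VF \<Longrightarrow> N X Y \<in> VF"
  by (simp add: tensor_deriv_def)

lemma N_swap: "X \<in> VF \<Longrightarrow> Y \<in> VF \<Longrightarrow> N X Y = - N Y X"
  using nc unfolding nearly_cosymplectic_def by (metis eq_neg_iff_add_eq_0)

lemma N_self: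
  assumes "X \<in> VF" shows "N X X = 0"
proof -
  have "N X X p f = 0" for p f
    using fun_cong[OF fun_cong[OF N_swap[OF assms assms]], of p f] by simp
  then show ?thesis by (simp add: fun_eq_iff)
qed

lemma pairing_zero: "X \<in> VF \<Longrightarrow> pairing 0 X p = 0"
  by (simp add: pairing_def metric_zero vector_fieldD)

text \<open>Differentiate the skew-symmetry of \<open>\<theta>\<close> in the direction
  \<open>X\<close>; the terms with \<open>D X Y\<close> and \<open>D X Z\<close> cancel, again by
  skew-symmetry.\<close>

lemma N_skew:
  assumes "X \<in> VF" "Y \<in> VF" "Z \<in> VF"
  shows "pairing (N X Y) Z p = - pairing Y (N X Z) p"
proof -
  have "pairing (T Y) Z = (\<lambda>q. - pairing (T Z) Y q)"
    using T_skew[OF assms(2,3)] pairing_sym[of Y "T Z"] assms by (intro ext) simp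
  then have "X p (pairing (T Y) Z) = - X p (pairing (T Z) Y)"
    by (simp add: derivation_uminus assms)
  then show ?thesis
    using assms T_skew[of "D X Y" Z p] T_skew[of Y "D X Z" p]
      pairing_sym[of "T Z" "D X Y" p] pairing_sym[of Y "D X (T Z)" p]
    by (simp add: compatible tensor_deriv_def pairing_left pairing_right)
qed

text \<open>This is the covariant derivative of \<open>\<theta>\<^sup>2 = - Id + \<eta> \<otimes> \<xi>\<close>.\<close>

lemma N_theta:
  assumes "Z \<in> VF" "Y \<in> VF" "W \<in> VF"
  shows "pairing (N Z Y) (T W) p + pairing (N Z W) (T Y) p =
    - (pairing (D Z \<xi>) Y p * pairing \<xi> W p + pairing \<xi> Y p * pairing (D Z \<xi>) W p)"
proof -
  \<comment> \<open>The Leibniz rule for the square of \<open>\<theta>\<close>: the two terms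
    \<open>T (D Z (T Y))\<close> cancel.\<close>
  have "N Z (T Y) + T (N Z Y) = D Z (T (T Y)) - T (T (D Z Y))"
    using assms by (simp add: tensor_deriv_def T_diff)
  also have "\<dots> = fscale (\<lambda>p. Z p (pairing \<xi> Y)) \<xi> + fscale (pairing \<xi> Y) (D Z \<xi>)
      - fscale (pairing \<xi> (D Z Y)) \<xi>"
    using assms by (simp add: T_T D_add_right D_diff_right D_fscale_right)
  finally have "pairing (N Z (T Y) + T (N Z Y)) W p =
      pairing (fscale (\<lambda>p. Z p (pairing \<xi> Y)) \<xi> + fscale (pairing \<xi> Y) (D Z \<xi>)
        - fscale (pairing \<xi> (D Z Y)) \<xi>) W p"
    by simp
  then have "pairing (N Z (T Y)) W p + pairing (T (N Z Y)) W p =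
      Z p (pairing \<xi> Y) * pairing \<xi> W p + pairing \<xi> Y p * pairing (D Z \<xi>) W p
        - pairing \<xi> (D Z Y) p * pairing \<xi> W p"
    using assms by (simp add: pairing_left vector_fieldD(2)[OF assms(1)])
  moreover have "Z p (pairing \<xi> Y) = pairing (D Z \<xi>) Y p + pairing \<xi> (D Z Y) p"
    using assms by (simp add: compatible)
  ultimately have "pairing (N Z (T Y)) W p + pairing (T (N Z Y)) W p =
      pairing (D Z \<xi>) Y p * pairing \<xi> W p + pairing \<xi> Y p * pairing (D Z \<xi>) W p"
    by (simp add: algebra_simps)
  \<comment> \<open>Moving \<open>N Z\<close> and \<open>T\<close> across the metric reverses the
    sign of both terms on the left.\<close>
  then show ?thesis
    using assms N_skew[of Z "T Y" W p] T_skew[of "N Z Y" W p] pairing_sym[of "T Y" "N Z W" p] by simp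
qed

section \<open>The Killing field\<close>

lemma D_xi_xi: "X \<in> VF \<Longrightarrow> pairing (D X \<xi>) \<xi> p = 0"
proof -
  assume X: "X \<in> VF"
  have "pairing \<xi> \<xi> = (\<lambda>q. 1)" by (rule ext) (rule pairing_xi_xi)
  then have "X p (pairing \<xi> \<xi>) = 0"
    by (simp add: tangent_const[OF atlas vector_fieldD(1)[OF X]])
  then show ?thesis
    using X by (simp add: compatible pairing_sym[of \<xi>])
qed

text \<open>For \<open>Z = W = Y\<close> the previous identity gives \<open>\<eta>(Y) g(\<nabla>\<^sub>Y\<xi>, Y) = 0\<close>. Where \<open>\<eta>(Y)\<close> vanishes, it is
  applied to \<open>Y \<plusminus> \<xi>\<close> instead.\<close>

lemma killing_diag:
  assumes Y: "Y \<in> VF"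
  shows "pairing (D Y \<xi>) Y p = 0"
proof -
  have *: "pairing (D Z \<xi>) Z p = 0" if "Z \<in> VF" "pairing \<xi> Z p \<noteq> 0" for Z
    using N_theta[of Z Z Z p] that by (simp add: N_self pairing_zero)
  show ?thesis
  proof (cases "pairing \<xi> Y p = 0")
    case True
    \<comment> \<open>Now \<open>\<eta>\<close> takes the values \<open>1\<close> and
      \<open>-1\<close> on these fields. In the sum of the two identities the cross terms with
      \<open>D \<xi> \<xi>\<close> cancel.\<close>
    have "pairing (D (Y + \<xi>) \<xi>) (Y + \<xi>) p = 0" "pairing (D (Y - \<xi>) \<xi>) (Y - \<xi>) p = 0"
      by (rule *; use Y True in \<open>simp add: pairing_right pairing_xi_xi\<close>)+
    then show ?thesis
      using Y by (simp add: D_add_left D_diff_left pairing_left pairing_right D_xi_xi)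
  qed (rule *[OF Y])
qed

text \<open>Polarisation of \<open>killing_diag\<close>.\<close>

lemma killing:
  assumes "X \<in> VF" "Y \<in> VF"
  shows "pairing (D X \<xi>) Y p = - pairing (D Y \<xi>) X p"
  using killing_diag[of "X + Y" p] killing_diag[of X p] killing_diag[of Y p] assms
  by (simp add: D_add_left pairing_left pairing_right)

text \<open>The left-hand side pairs the second covariant derivative of \<open>\<xi>\<close> along
  \<open>X, X\<close> with \<open>Y\<close>. Differentiate \<open>killing_diag\<close> for
  \<open>X\<close> in the direction \<open>Y\<close>, and \<open>killing\<close> in the direction
  \<open>X\<close>; their difference contains the commutator that defines the curvature applied to
  \<open>\<xi>\<close>.\<close>

lemma killing_second_derivative:
  assumes X: "X \<in> VF" and Y: "Y \<in> VF"
  shows "pairing (D X (D X \<xi>)) Y p - pairing (D (D X X) \<xi>) Y p = pairing (curvature D X Y X) \<xi> p"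
proof -
  have "pairing (D X \<xi>) X = (\<lambda>q. 0)"
    by (rule ext) (rule killing_diag[OF X])
  then have "Y p (pairing (D X \<xi>) X) = 0"
    by (simp add: tangent_const[OF atlas vector_fieldD(1)[OF Y]])
  then have 1: "pairing (D Y (D X \<xi>)) X p = - pairing (D X \<xi>) (D Y X) p"
    using X Y by (simp add: compatible)
  have "pairing (D Y \<xi>) X = (\<lambda>q. - pairing (D X \<xi>) Y q)"
    by (rule ext) (rule killing[OF Y X])
  then have "X p (pairing (D Y \<xi>) X) = - X p (pairing (D X \<xi>) Y)"
    using X Y by (simp add: derivation_uminus)
  then have 2: "pairing (D X (D Y \<xi>)) X p + pairing (D Y \<xi>) (D X X) p =
      - pairing (D X (D X \<xi>)) Y p - pairing (D X \<xi>) (D X Y) p"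
    using X Y by (simp add: compatible)
  have "pairing (curvature D X Y \<xi>) X p = pairing (D X (D Y \<xi>)) X p - pairing (D Y (D X \<xi>)) X p
      - pairing (D (D X Y) \<xi>) X p + pairing (D (D Y X) \<xi>) X p"
    using X Y by (simp add: curvature_def torsion_free D_diff_left pairing_left)
  then show ?thesis
    using 1 2 X Y curvature_skew[OF X Y X xi_VF, of p]
      killing[of "D X Y" X p] killing[of "D Y X" X p] killing[of "D X X" Y p]
    by simp
qed

text \<open>The left-hand side is the second covariant derivative of \<open>\<theta>\<close> along
  \<open>X, X\<close>, applied to \<open>Y\<close>. Antisymmetry of \<open>N\<close> turns it into
  minus the derivative along \<open>X, Y\<close> applied to \<open>X\<close>, and commuting the two
  directions brings in the curvature.\<close>

lemma ricci_identity:
  assumes X: "X \<in> VF" and Y: "Y \<in> VF"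
  shows "D X (N X Y) - N (D X X) Y - N X (D X Y) = T (curvature D X Y X) - curvature D X Y (T X)"
proof -
  have NYX: "N X Y = - N Y X" using X Y by (rule N_swap)
  \<comment> \<open>Together \<open>1\<close> and \<open>2\<close> say that the second derivative
    along \<open>Y, X\<close> annihilates \<open>X\<close>: \<open>1\<close> differentiates
    \<open>N X X = 0\<close>, and \<open>2\<close> is antisymmetry of \<open>N\<close> for
    \<open>D Y X\<close> and \<open>X\<close>.\<close>
  have "D Y (N X X) = 0"
    using X Y D_diff_right[of Y 0 0] by (simp add: N_self)
  then have 1: "D Y (D X (T X)) = D Y (T (D X X))"
    using X Y by (simp add: tensor_deriv_def D_diff_right)
  have 2: "D (D Y X) (T X) = T (D (D Y X) X) - (D X (T (D Y X)) - T (D X (D Y X)))"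
    using N_swap[of "D Y X" X] X Y by (simp add: tensor_deriv_def diff_eq_eq)
  have "N (D X X) Y = - N Y (D X X)" "N X (D X Y) = - N (D X Y) X"
    using X Y by (auto intro: N_swap)
  then have "D X (N X Y) - N (D X X) Y - N X (D X Y) = N Y (D X X) + N (D X Y) X - D X (N Y X)"
    using X Y by (simp add: NYX D_uminus_right)
  also have "\<dots> = D Y (T (D X X)) - T (D Y (D X X)) + (D (D X Y) (T X) - T (D (D X Y) X))
      - (D X (D Y (T X)) - D X (T (D Y X)))"
    using X Y by (simp add: tensor_deriv_def D_diff_right)
  also have "\<dots> = T (D X (D Y X)) - T (D Y (D X X)) - (T (D (D X Y) X) - T (D (D Y X) X))
      - (D X (D Y (T X)) - D Y (D X (T X)) - (D (D X Y) (T X) - D (D Y X) (T X)))"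
    unfolding 1 2 by (simp add: algebra_simps)
  also have "\<dots> = T (curvature D X Y X) - curvature D X Y (T X)"
    using X Y by (simp add: curvature_def torsion_free D_diff_left T_diff)
  finally show ?thesis .
qed

lemma norm_nabla_theta:
  assumes X: "X \<in> VF" and Y: "Y \<in> VF"
  shows "pairing (N X Y) (N X Y) p + (pairing Y (D X \<xi>) p)\<^sup>2 =
    - pairing (curvature D X Y X) Y p + pairing (curvature D X Y (T X)) (T Y) p"
proof -
  have diag: "pairing (N Z Y) (T Y) q = - (pairing \<xi> Y q * pairing (D Z \<xi>) Y q)" if "Z \<in> VF" for Z q
    using N_theta[OF that Y Y, of q] by (simp add: mult.commute)
  \<comment> \<open>The identity \<open>diag\<close> holds at every point, so it may be
    differentiated along \<open>X\<close>.\<close>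
  have "pairing (N X Y) (T Y) = (\<lambda>q. - (pairing \<xi> Y q * pairing (D X \<xi>) Y q))"
    by (rule ext) (rule diag[OF X])
  then have "X p (pairing (N X Y) (T Y)) =
      - (pairing \<xi> Y p * X p (pairing (D X \<xi>) Y) + pairing (D X \<xi>) Y p * X p (pairing \<xi> Y))"
    using X Y derivation_uminus[OF X smooth_fun_mult[OF atlas], of "pairing \<xi> Y" "pairing (D X \<xi>) Y" p]
      derivation_mult[OF X, of "pairing \<xi> Y" "pairing (D X \<xi>) Y" p]
    by simp
  moreover have "D X (T Y) = N X Y + T (D X Y)"
    by (simp add: tensor_deriv_def)
  ultimately have 1: "pairing (D X (N X Y)) (T Y) p + pairing (N X Y) (N X Y) p
      + pairing (N X Y) (T (D X Y)) p =
      - (pairing \<xi> Y p * (pairing (D X (D X \<xi>)) Y p + pairing (D X \<xi>) (D X Y) p)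
        + pairing (D X \<xi>) Y p * (pairing (D X \<xi>) Y p + pairing \<xi> (D X Y) p))"
    using X Y by (simp add: compatible pairing_right)
  \<comment> \<open>Taking \<open>W = D X Y\<close> in \<open>N_theta\<close> disposes of all terms
    of \<open>1\<close> in which \<open>D X Y\<close> occurs, leaving \<open>N X (D X Y)\<close>,
    which belongs to the second derivative of \<open>\<theta>\<close>.\<close>
  have 2: "pairing (N X Y) (T (D X Y)) p + pairing (N X (D X Y)) (T Y) p =
      - (pairing (D X \<xi>) Y p * pairing \<xi> (D X Y) p + pairing \<xi> Y p * pairing (D X \<xi>) (D X Y) p)"
    using X Y by (intro N_theta) simp_all
  have 3: "pairing (N (D X X) Y) (T Y) p = - (pairing \<xi> Y p * pairing (D (D X X) \<xi>) Y p)"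
    using X by (intro diag) simp
  have 4: "pairing (D X (N X Y)) (T Y) p - pairing (N (D X X) Y) (T Y) p - pairing (N X (D X Y)) (T Y) p
      = pairing (T (curvature D X Y X)) (T Y) p - pairing (curvature D X Y (T X)) (T Y) p"
    using X Y arg_cong[OF ricci_identity[OF X Y], of "\<lambda>Z. pairing Z (T Y) p"]
    by (simp add: pairing_left)
  \<comment> \<open>As \<open>\<theta>\<close> is isometric only up to \<open>\<eta>\<close>, a
    curvature term with the factor \<open>pairing \<xi> Y\<close> remains. The next fact, from the
    Killing field, cancels it against the second derivatives of \<open>\<xi>\<close> in
    \<open>1\<close> and \<open>3\<close>.\<close>
  have 5: "pairing (T (curvature D X Y X)) (T Y) p =
      pairing (curvature D X Y X) Y p - pairing (curvature D X Y X) \<xi> p * pairing \<xi> Y p"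
    using X Y by (simp add: pairing_T_T pairing_sym[of \<xi>])
  have "pairing \<xi> Y p * (pairing (D X (D X \<xi>)) Y p - pairing (D (D X X) \<xi>) Y p) =
      pairing (curvature D X Y X) \<xi> p * pairing \<xi> Y p"
    by (simp add: killing_second_derivative X Y)
  moreover have "pairing Y (D X \<xi>) p = pairing (D X \<xi>) Y p"
    using X Y by (simp add: pairing_sym)
  ultimately show ?thesis
    using 1 2 3 4 5 by algebra
qed

end

theorem proposition3p1:
  fixes A :: "('m::{t2_space,second_countable_topology}, 'e::euclidean_space) atlas"
    and n :: nat
    and g :: "'m \<Rightarrow> 'm tvec \<Rightarrow> 'm tvec \<Rightarrow> real"
    and D :: "'m vfield \<Rightarrow> 'm vfield \<Rightarrow> 'm vfield"
    and \<theta> :: "'m \<Rightarrow> 'm tvec \<Rightarrow> 'm tvec"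
    and \<xi> :: "'m vfield"
    and \<eta> :: "'m \<Rightarrow> 'm tvec \<Rightarrow> real"
    and p :: 'm
    and x y :: "'m tvec"
  assumes "smooth_atlas A"
    and "DIM('e) = 2 * n + 1"
    and "levi_civita A g D"
    and "nearly_cosymplectic A \<theta> \<xi> \<eta> g D"
    and "x \<in> tangent_space A p"
    and "y \<in> tangent_space A p"
  shows "(metric_norm g p (tensor_deriv_at A D \<theta> p x y))\<^sup>2 + (g p y (deriv_at A D p x \<xi>))\<^sup>2
    = - riemann_at A g D p x y x y + riemann_at A g D p x y (\<theta> p x) (\<theta> p y)"
proof -
  interpret nearly_cosymplectic_manifold A g D \<theta> \<xi> \<eta>
    using assms(1,3,4)
    by unfold_locales (simp_all add: nearly_cosymplectic_def almost_contact_metric_def)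
  define X where "X = extension A p x"
  define Y where "Y = extension A p y"
  have X: "X \<in> VF" "X p = x" and Y: "Y \<in> VF" "Y p = y"
    using extension[OF assms(1)] assms(5,6) by (simp_all add: X_def Y_def)
  \<comment> \<open>\<open>riemann_at\<close> extends \<open>\<theta> p x\<close> independently of
    \<open>X\<close>, so \<open>Z\<close> is known to agree with \<open>T X\<close> only at
    \<open>p\<close>.\<close>
  define Z where "Z = extension A p (\<theta> p x)"
  have Z: "Z \<in> VF" "Z p = T X p"
    using extension[OF assms(1) theta_closed[OF assms(5)]] X(2) by (simp_all add: Z_def apply_tensor_def)
  \<comment> \<open>Nonnegativity lets the square cancel the root in \<open>metric_norm\<close>; the
    zero vector is treated apart because positivity is assumed for nonzero vectors only.\<close>
  have "g p (N X Y p) (N X Y p) \<ge> 0"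
    using metric_pos[of "N X Y p" p] metric_zero[of "N X Y p" p]
      vector_fieldD(1)[OF N_closed[OF X(1) Y(1)], of p]
    by (cases "N X Y p = 0") (auto simp: less_imp_le)
  then have "(metric_norm g p (tensor_deriv_at A D \<theta> p x y))\<^sup>2 = pairing (N X Y) (N X Y) p"
    by (simp add: metric_norm_def tensor_deriv_at_def pairing_def X_def Y_def)
  moreover have "g p y (deriv_at A D p x \<xi>) = pairing Y (D X \<xi>) p"
    by (simp add: deriv_at_def pairing_def X_def Y)
  moreover have "riemann_at A g D p x y x y = pairing (curvature D X Y X) Y p"
    using Y(2) by (simp add: riemann_at_def pairing_def X_def Y_def)
  moreover have "riemann_at A g D p x y (\<theta> p x) (\<theta> p y) = pairing (curvature D X Y Z) (T Y) p"
    using Y(2) by (simp add: riemann_at_def pairing_def X_def Y_def Z_def apply_tensor_def)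
  moreover have "pairing (curvature D X Y Z) (T Y) p = pairing (curvature D X Y (T X)) (T Y) p"
    using X Y Z by (intro curvature_tensorial) simp_all
  ultimately show ?thesis
    using norm_nabla_theta[OF X(1) Y(1), of p] by simp
qed

end
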